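(* Consider the one-dimensional monopolist disclosure game with rich evidence described in the context, and suppose that $[\underline v,\overline v]=[0,1]$ and the CDF of valuations is $F(v)=v^k$ for some $k>0$. Then the greedy segmentation is the consumer-optimal equilibrium segmentation: the equilibrium given by the greedy segmentation maximizes the consumer's ex ante expected payoff among all equilibria of the game.
   Context: Game. A monopolist sells a good to one consumer with unit demand. The consumer's type (equal to her valuation) $t$ is drawn from CDF $F$ with support $[\underline v,\overline v]$. The consumer observes $t$ and sends a message from $\mathcal M(t)=\{[a,b]\subseteq[\underline v,\overline v]: a\le t\le b\}$ (rich evidence: all closed intervals, possibly degenerate, containing $t$). The monopolist observes the message and chooses a price $p\ge0$; the consumer then decides whether to buy, buying when indifferent. If she buys at $p$ her payoff is $t-p$ and the monopolist's is $p$; otherwise both get $0$. Equilibrium means Perfect Bayesian Equilibrium: beliefs follow Bayes' rule whenever possible, after every message $m$ (on or off path) the belief is supported in $m$, and both players are sequentially rational. For an equilibrium $\sigma$, $m^\sigma(t)$ denotes the message sent by type $t$ and $p^\sigma(m)$ the price charged after message $m$. Greedy segmentation. Let $p_0=\overline v$ and, for each $s\ge1$ with $p_{s-1}>\underline v$, let $p_s$ be the lowest maximizer over $p$ of $p\,(F(p_{s-1})-F(p))$, halting if $p_s=\underline v$. In the greedy segmentation, every type $t$ with $p_s<t\le p_{s-1}$ sends the message $[p_s,p_{s-1}]$ and is charged $p_s$ (and buys), and type $\underline v$ sends $\{\underline v\}$ and is charged $\underline v$. (This is the outcome of an equilibrium of the game.) *)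

theory Defs
  imports "HOL-Probability.Probability"
begin

text \<open>
  A closed interval $[a,b]$ is encoded by its pair of endpoints, so that the set of all messages is
  a Borel subset of the plane.  The consumer's types range over \<^term>\<open>{lo..hi}\<close>.
\<close>

definition messages :: "real \<Rightarrow> real \<Rightarrow> real \<Rightarrow> (real \<times> real) set" where
  "messages lo hi t = {(a, b). lo \<le> a \<and> a \<le> t \<and> t \<le> b \<and> b \<le> hi}"

definition message_space :: "real \<Rightarrow> real \<Rightarrow> (real \<times> real) set" where
  "message_space lo hi = (\<Union>t\<in>{lo..hi}. messages lo hi t)"

text \<open>
  In \<open>buys \<sigma> t m q\<close>, type \<open>t\<close> has sent \<open>m\<close> and is offered the price \<open>q\<close>.
\<close>

record assessment =
  message :: "real \<Rightarrow> real \<times> real"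
  price :: "real \<times> real \<Rightarrow> real"
  buys :: "real \<Rightarrow> real \<times> real \<Rightarrow> real \<Rightarrow> bool"
  belief :: "real \<times> real \<Rightarrow> real measure"

definition consumer_payoff :: "assessment \<Rightarrow> real \<Rightarrow> real \<times> real \<Rightarrow> real" where
  "consumer_payoff \<sigma> t m = (if buys \<sigma> t m (price \<sigma> m) then t - price \<sigma> m else 0)"

definition expected_revenue :: "assessment \<Rightarrow> real \<times> real \<Rightarrow> real \<Rightarrow> real" where
  "expected_revenue \<sigma> m q = q * measure (belief \<sigma> m) {t \<in> {fst m..snd m}. buys \<sigma> t m q}"

definition ex_ante_consumer_payoff ::
    "real measure \<Rightarrow> real \<Rightarrow> real \<Rightarrow> assessment \<Rightarrow> real" where
  "ex_ante_consumer_payoff P lo hi \<sigma> =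
     (LINT t:{lo..hi}|P. consumer_payoff \<sigma> t (message \<sigma> t))"

definition feasible :: "real \<Rightarrow> real \<Rightarrow> assessment \<Rightarrow> bool" where
  "feasible lo hi \<sigma> \<longleftrightarrow>
     message \<sigma> \<in> restrict_space borel {lo..hi} \<rightarrow>\<^sub>M borel \<and>
     (\<forall>t\<in>{lo..hi}. message \<sigma> t \<in> messages lo hi t) \<and>
     price \<sigma> \<in> restrict_space borel (message_space lo hi) \<rightarrow>\<^sub>M borel \<and>
     (\<forall>m\<in>message_space lo hi. 0 \<le> price \<sigma> m)"

definition beliefs_supported :: "real \<Rightarrow> real \<Rightarrow> assessment \<Rightarrow> bool" where
  "beliefs_supported lo hi \<sigma> \<longleftrightarrow>
     belief \<sigma> \<in> restrict_space borel (message_space lo hi) \<rightarrow>\<^sub>M prob_algebra borel \<and>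
     (\<forall>m\<in>message_space lo hi. measure (belief \<sigma> m) {fst m..snd m} = 1)"

text \<open>
  Bayes' rule for a continuum of types: the beliefs are a regular conditional distribution of the
  type given the message.  For a message sent with positive probability, taking \<open>B\<close> to be
  the singleton of that message gives the elementary Bayes formula.
\<close>

definition bayes_consistent :: "real measure \<Rightarrow> real \<Rightarrow> real \<Rightarrow> assessment \<Rightarrow> bool" where
  "bayes_consistent P lo hi \<sigma> \<longleftrightarrow>
     (\<forall>A \<in> sets borel. \<forall>B \<in> sets borel.
        measure P {t \<in> {lo..hi}. t \<in> A \<and> message \<sigma> t \<in> B} =
        (LINT t:{t \<in> {lo..hi}. message \<sigma> t \<in> B}|P. measure (belief \<sigma> (message \<sigma> t)) A))"

definition purchase_rational :: "real \<Rightarrow> real \<Rightarrow> assessment \<Rightarrow> bool" where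
  "purchase_rational lo hi \<sigma> \<longleftrightarrow>
     (\<forall>t\<in>{lo..hi}. \<forall>m\<in>messages lo hi t. \<forall>q\<ge>0.
        (t - q > 0 \<longrightarrow> buys \<sigma> t m q) \<and>
        (t - q < 0 \<longrightarrow> \<not> buys \<sigma> t m q) \<and>
        (t - q = 0 \<longrightarrow> buys \<sigma> t m q))"

definition pricing_rational :: "real \<Rightarrow> real \<Rightarrow> assessment \<Rightarrow> bool" where
  "pricing_rational lo hi \<sigma> \<longleftrightarrow>
     (\<forall>m\<in>message_space lo hi. \<forall>q\<ge>0.
        expected_revenue \<sigma> m q \<le> expected_revenue \<sigma> m (price \<sigma> m))"

definition disclosure_rational :: "real \<Rightarrow> real \<Rightarrow> assessment \<Rightarrow> bool" where
  "disclosure_rational lo hi \<sigma> \<longleftrightarrow>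
     (\<forall>t\<in>{lo..hi}. \<forall>m\<in>messages lo hi t.
        consumer_payoff \<sigma> t m \<le> consumer_payoff \<sigma> t (message \<sigma> t))"

definition equilibrium :: "real measure \<Rightarrow> real \<Rightarrow> real \<Rightarrow> assessment \<Rightarrow> bool" where
  "equilibrium P lo hi \<sigma> \<longleftrightarrow>
     feasible lo hi \<sigma> \<and>
     beliefs_supported lo hi \<sigma> \<and>
     bayes_consistent P lo hi \<sigma> \<and>
     purchase_rational lo hi \<sigma> \<and>
     pricing_rational lo hi \<sigma> \<and>
     disclosure_rational lo hi \<sigma>"

definition consumer_optimal_equilibrium ::
    "real measure \<Rightarrow> real \<Rightarrow> real \<Rightarrow> assessment \<Rightarrow> bool" where
  "consumer_optimal_equilibrium P lo hi \<sigma> \<longleftrightarrow>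
     equilibrium P lo hi \<sigma> \<and>
     (\<forall>\<tau>. equilibrium P lo hi \<tau> \<longrightarrow>
        ex_ante_consumer_payoff P lo hi \<tau> \<le> ex_ante_consumer_payoff P lo hi \<sigma>)"

text \<open>
  Once the greedy procedure halts, the sequence stays constant, so that the later segments
  \<^term>\<open>{greedy_price F lo hi (Suc s)<..greedy_price F lo hi s}\<close> are empty.
\<close>

primrec greedy_price :: "(real \<Rightarrow> real) \<Rightarrow> real \<Rightarrow> real \<Rightarrow> nat \<Rightarrow> real" where
  "greedy_price F lo hi 0 = hi"
| "greedy_price F lo hi (Suc s) =
     (if lo < greedy_price F lo hi s
      then LEAST p. is_arg_max (\<lambda>p. p * (F (greedy_price F lo hi s) - F p)) (\<lambda>p. 0 \<le> p) p
      else greedy_price F lo hi s)"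

definition greedy_segmentation ::
    "(real \<Rightarrow> real) \<Rightarrow> real \<Rightarrow> real \<Rightarrow> assessment \<Rightarrow> bool" where
  "greedy_segmentation F lo hi \<sigma> \<longleftrightarrow>
     (\<forall>s t. greedy_price F lo hi (Suc s) < t \<and> t \<le> greedy_price F lo hi s \<longrightarrow>
        message \<sigma> t = (greedy_price F lo hi (Suc s), greedy_price F lo hi s) \<and>
        price \<sigma> (message \<sigma> t) = greedy_price F lo hi (Suc s) \<and>
        buys \<sigma> t (message \<sigma> t) (price \<sigma> (message \<sigma> t))) \<and>
     message \<sigma> lo = (lo, lo) \<and> price \<sigma> (lo, lo) = lo"

end

theory Submission
  imports Defs
begin

text \<open>
  Let \<open>r = (k + 1) powr (- 1 / k)\<close>, so that the greedy prices are \<open>r ^ s\<close>, and call the minimum of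
  a type's value and the price charged to her her effective price; her payoff is her value minus
  this.  In any equilibrium the effective price is monotone in the type.  If it is below the value
  for some type, then it is constant, equal to \<open>a\<close>, on a maximal block between \<open>a\<close> and some \<open>b\<close>:
  otherwise some message would be bought only by types well above its price.  Since the monopoly price
  against \<open>{0..b}\<close> is \<open>r * b\<close>, we have \<open>r * b \<le> a\<close>.  By concavity, every such block has mean
  effective price at least \<open>w\<close> times its mean value, where \<open>w = r * (k + 1) / (k + 1 - r) \<le> 1\<close>,
  with equality if \<open>a = r * b\<close>, as in every greedy segment.  Summing over the countably many disjoint
  blocks shows that the consumer's payoff is at most \<open>1 - w\<close> times the mean value, and that the
  greedy segmentation attains this.
\<close>

subsection \<open>Revenue under a power distribution function\<close>

locale power_exponent =
  fixes k :: real
  assumes k_pos: "0 < k"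
begin

text \<open>The monopoly price against all types: for \<open>p > 0\<close> the derivative
  \<open>1 - (k + 1) * p powr k\<close> of the revenue \<open>p * (1 - p powr k)\<close> vanishes
  exactly here.\<close>

definition ratio :: real where
  "ratio = (k + 1) powr (- 1 / k)"

text \<open>On a segment from \<open>ratio * b\<close> to \<open>b\<close> the integral of the price
  is \<open>ratio * k / (k + 1)\<close> and that of the value is
  \<open>k / (k + 1) * (1 - ratio / (k + 1))\<close>, both times \<open>b powr (k + 1)\<close>; this
  is their quotient.\<close>

definition price_share :: real where
  "price_share = ratio * (k + 1) / (k + 1 - ratio)"

lemma ratio_pos: "0 < ratio"
  unfolding ratio_def using k_pos by simp

lemma ratio_less_1: "ratio < 1"
  unfolding ratio_def using k_pos powr_less_mono[of "- 1 / k" 0 "k + 1"] by simp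

lemma ratio_powr: "ratio powr k = 1 / (k + 1)"
proof -
  have "ratio powr k = (k + 1) powr - 1"
    unfolding ratio_def powr_powr using k_pos by simp
  then show ?thesis using k_pos by (simp add: powr_minus_divide)
qed

lemma ratio_powr_Suc: "ratio powr (k + 1) = ratio / (k + 1)"
  using ratio_pos ratio_powr by (simp add: powr_add)

lemma price_share_pos: "0 < price_share"
  unfolding price_share_def using ratio_pos ratio_less_1 k_pos by simp

text \<open>Equivalent to \<open>1 + 1 / (k + 1) \<le> 1 / ratio\<close>. After logarithms
  \<open>1 / (k + 1)\<close> separates the two sides: \<open>ln (1 + x) \<le> x\<close> handles the
  left one, and \<open>ln y \<le> y - 1\<close> at \<open>y = 1 / (k + 1)\<close> handles the right
  one, \<open>ln (k + 1) / k\<close>.\<close>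

lemma price_share_le_1: "price_share \<le> 1"
proof -
  have "1 / (k + 1) - 1 \<ge> ln (1 / (k + 1))"
    using k_pos by (intro ln_le_minus_one) simp
  then have "k / (k + 1) \<le> ln (k + 1)"
    using k_pos by (simp add: ln_div field_simps)
  then have "1 / (k + 1) \<le> ln (k + 1) / k"
    using k_pos by (simp add: field_simps)
  moreover have "ln (1 + 1 / (k + 1)) \<le> 1 / (k + 1)"
    using k_pos by (intro ln_add_one_self_le_self) simp
  ultimately have "ln (1 + 1 / (k + 1)) \<le> - ln ratio"
    unfolding ratio_def using k_pos by (simp add: ln_powr)
  then have "ln (1 + 1 / (k + 1)) \<le> ln (1 / ratio)"
    using ratio_pos by (simp add: ln_div)
  then have "1 + 1 / (k + 1) \<le> 1 / ratio"
    using ratio_pos k_pos by (subst (asm) ln_le_cancel_iff) (auto intro: add_pos_pos)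
  then have "ratio * (k + 2) \<le> k + 1"
    using ratio_pos k_pos by (simp add: field_simps)
  then show ?thesis
    unfolding price_share_def using ratio_pos ratio_less_1 k_pos by (simp add: field_simps)
qed

text \<open>The tangent at 1 lies strictly below a strictly convex power; the mean value theorem
  shows this on either side of 1. The point 0 is split off because the power rule for derivatives is
  for positive arguments.\<close>

lemma strict_Bernoulli_powr:
  assumes "0 \<le> y" "y \<noteq> 1"
  shows "1 + (k + 1) * (y - 1) < y powr (k + 1)"
proof (cases "y = 0")
  case True
  then show ?thesis using k_pos by simp
next
  case False
  with assms have y: "0 < y" by simp
  have der: "((\<lambda>x. x powr (k + 1)) has_real_derivative (k + 1) * x powr k) (at x)" if "0 < x" for x
    using has_real_derivative_powr[OF that, of "k + 1"] by simp
  show ?thesis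
  proof (cases "1 < y")
    case True
    obtain z where z: "1 < z" "z < y" "y powr (k + 1) - 1 powr (k + 1) = (y - 1) * ((k + 1) * z powr k)"
      using MVT2[OF True, of "\<lambda>x. x powr (k + 1)" "\<lambda>x. (k + 1) * x powr k"] der by auto
    have "1 < z powr k" using z k_pos by simp
    then have "(y - 1) * ((k + 1) * 1) < (y - 1) * ((k + 1) * z powr k)"
      using True k_pos by (intro mult_strict_left_mono) auto
    with z show ?thesis by (simp add: algebra_simps)
  next
    case False
    with assms have y1: "y < 1" by simp
    obtain z where z: "y < z" "z < 1" "1 powr (k + 1) - y powr (k + 1) = (1 - y) * ((k + 1) * z powr k)"
      using MVT2[OF y1, of "\<lambda>x. x powr (k + 1)" "\<lambda>x. (k + 1) * x powr k"] der y by auto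
    have "z powr k < 1" using powr_less_mono2[of k z 1] z y k_pos by simp
    then have "(1 - y) * ((k + 1) * z powr k) < (1 - y) * ((k + 1) * 1)"
      using y1 k_pos by (intro mult_strict_left_mono) auto
    with z show ?thesis by (simp add: algebra_simps)
  qed
qed

text \<open>With \<open>p = ratio * d * y\<close>, division by \<open>ratio * d * d powr k\<close>
  leaves Bernoulli's inequality for \<open>y\<close>. Strictness makes the optimal price
  unique.\<close>

lemma revenue_less_ratio:
  assumes "0 \<le> p" "0 < d" "p \<noteq> ratio * d"
  shows "p * (d powr k - p powr k) < ratio * d * (d powr k - (ratio * d) powr k)"
proof -
  define y where "y = p / (ratio * d)"
  have p: "p = ratio * d * y" and y: "0 \<le> y" "y \<noteq> 1"
    unfolding y_def using assms ratio_pos by auto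
  have *: "p * (d powr k - p powr k) = ratio * d * d powr k * (y - y powr (k + 1) / (k + 1))"
  proof -
    have "p powr k = d powr k * y powr k / (k + 1)"
      using assms(2) y(1) ratio_pos ratio_powr unfolding p by (simp add: powr_mult)
    then show ?thesis
      using y(1) unfolding p by (simp add: powr_add algebra_simps)
  qed
  have **: "ratio * d * (d powr k - (ratio * d) powr k) = ratio * d * d powr k * (1 - 1 / (k + 1))"
    using assms(2) ratio_pos ratio_powr by (simp add: powr_mult algebra_simps)
  have "y - y powr (k + 1) / (k + 1) < 1 - 1 / (k + 1)"
  proof -
    have "(k + 1) * y - k < y powr (k + 1)"
      using strict_Bernoulli_powr[OF y] by (simp add: algebra_simps)
    then have "((k + 1) * y - k) / (k + 1) < y powr (k + 1) / (k + 1)"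
      using k_pos by (intro divide_strict_right_mono) auto
    then show ?thesis using k_pos by (simp add: diff_divide_distrib) (simp add: field_simps)
  qed
  then show ?thesis
    unfolding * ** using assms(2) ratio_pos by (intro mult_strict_left_mono) auto
qed

text \<open>The factor after \<open>price_share\<close> is the integral of the value over the
  segment (see \<open>nn_integral_Ioc\<close>), the left side that of the price.\<close>

lemma block_price_eq:
  assumes "0 < b"
  shows "ratio * b * (b powr k - (ratio * b) powr k) =
    price_share * (k / (k + 1) * (b powr (k + 1) - (ratio * b) powr (k + 1)))"
proof -
  have nz: "k + 1 - ratio \<noteq> 0" "k + 1 \<noteq> 0" using ratio_less_1 k_pos by auto
  have "ratio * b * (b powr k - (ratio * b) powr k) = b powr (k + 1) * (ratio * (1 - 1 / (k + 1)))"
    using assms ratio_pos ratio_powr by (simp add: powr_mult powr_add algebra_simps)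
  also have "ratio * (1 - 1 / (k + 1)) = price_share * (k / (k + 1) * (1 - ratio / (k + 1)))"
    using nz unfolding price_share_def by (simp add: divide_simps)
  also have "b powr (k + 1) * \<dots> = price_share * (k / (k + 1) * (b powr (k + 1) - (ratio * b) powr (k + 1)))"
    using assms ratio_pos ratio_powr_Suc by (simp add: powr_mult algebra_simps)
  finally show ?thesis .
qed

text \<open>The gap between the two sides is concave in \<open>a\<close> and vanishes at
  \<open>a = ratio * b\<close> and at \<open>a = b\<close>.\<close>

lemma block_price_ge:
  assumes "0 < b" "ratio * b \<le> a" "a \<le> b"
  shows "price_share * (k / (k + 1) * (b powr (k + 1) - a powr (k + 1))) \<le> a * (b powr k - a powr k)"
proof -
  define x where "x = a / b"
  \<comment> \<open>The weight that writes \<open>x\<close> as a convex combination of 1 and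
    \<open>ratio\<close>.\<close>
  define l where "l = (1 - x) / (1 - ratio)"
  define v where "v = price_share * (k / (k + 1))"
  have a: "a = b * x" and x: "ratio \<le> x" "x \<le> 1"
    unfolding x_def using assms by (auto simp: field_simps)
  have x0: "0 < x" using ratio_pos x(1) by linarith
  have l: "0 \<le> l" "l \<le> 1" and l1: "l * (1 - ratio) = 1 - x"
    unfolding l_def using x ratio_less_1 by (auto simp: field_simps)
  then have xl: "x = (1 - l) * 1 + l * ratio"
    by (simp add: algebra_simps)
  have nz: "k + 1 - ratio \<noteq> 0" "k + 1 \<noteq> 0" using ratio_less_1 k_pos by auto
  have v1: "1 - v = (k + 1) * (1 - ratio) / (k + 1 - ratio)"
    unfolding v_def price_share_def using nz by (simp add: divide_simps) (simp add: algebra_simps)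
  have v0: "0 \<le> 1 - v" unfolding v1 using ratio_less_1 k_pos by simp
  have vr: "(1 - v) * (ratio / (k + 1)) = ratio - v"
    unfolding v1 v_def price_share_def using nz by (simp add: divide_simps) (simp add: algebra_simps)
  \<comment> \<open>The chord of the convex power over \<open>{ratio..1}\<close>. Multiplied by
    \<open>1 - v\<close> it becomes the line \<open>x - v\<close>, because \<open>vr\<close> matches
    the two at \<open>ratio\<close>.\<close>
  have "x powr (k + 1) \<le> (1 - l) * 1 powr (k + 1) + l * ratio powr (k + 1)"
    using convex_onD[OF powr_convex[of "k + 1"], of l 1 ratio] l ratio_pos k_pos
    unfolding xl by (simp add: algebra_simps)
  then have "(1 - v) * x powr (k + 1) \<le> (1 - v) * ((1 - l) + l * (ratio / (k + 1)))"
    using v0 ratio_powr_Suc by (intro mult_left_mono) auto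
  also have "\<dots> = (1 - v) * (1 - l) + l * ((1 - v) * (ratio / (k + 1)))"
    by (simp add: algebra_simps)
  also have "\<dots> = x - v" unfolding vr xl by (simp add: algebra_simps)
  finally have "v * (1 - x powr (k + 1)) \<le> x - x powr (k + 1)"
    by (simp add: algebra_simps)
  then have "b powr (k + 1) * (v * (1 - x powr (k + 1))) \<le> b powr (k + 1) * (x - x powr (k + 1))"
    by (intro mult_left_mono) auto
  also have "\<dots> = a * (b powr k - a powr k)"
    using assms(1) x0 unfolding a by (simp add: powr_mult powr_add algebra_simps)
  also have "b powr (k + 1) * (v * (1 - x powr (k + 1))) =
      price_share * (k / (k + 1) * (b powr (k + 1) - a powr (k + 1)))"
    unfolding v_def a powr_mult by (simp only: right_diff_distrib mult_1_right mult_ac)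
  finally show ?thesis .
qed

end

section \<open>Measures and integrals under the type distribution\<close>

locale power_distribution = real_distribution P + power_exponent k
  for P :: "real measure" and k :: real +
  assumes cdf_eq_powr: "v \<in> {0..1} \<Longrightarrow> cdf P v = v powr k"
begin

lemma cdf_eq: "cdf P x = (if x < 0 then 0 else if x \<le> 1 then x powr k else 1)"
proof -
  have "cdf P x = 0" if "x < 0"
    using cdf_nondecreasing[of x 0] cdf_nonneg[of x] cdf_eq_powr[of 0] that by simp
  moreover have "cdf P x = 1" if "1 < x"
    using cdf_nondecreasing[of 1 x] cdf_bounded_prob[of x] cdf_eq_powr[of 1] that by simp
  ultimately show ?thesis using cdf_eq_powr[of x] by auto
qed

text \<open>Inverse transform sampling. It reduces atoms and integrals of \<open>P\<close> to
  Lebesgue measure.\<close>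

lemma P_eq_distr_uniform:
  "P = distr (uniform_measure lborel {0..1}) borel (\<lambda>u. u powr (1 / k))"
proof -
  let ?U = "uniform_measure lborel {0..1::real}"
  interpret U: prob_space ?U by (rule prob_space_uniform_measure) auto
  let ?D = "distr ?U borel (\<lambda>u. u powr (1 / k))"
  interpret D: real_distribution ?D by (rule U.real_distribution_distr) simp
  have cdfD: "cdf ?D v = v powr k" if v: "v \<in> {0..1}" for v
  proof -
    have "u powr (1 / k) \<le> v \<longleftrightarrow> u \<le> v powr k" if "0 \<le> u" for u
      using v that k_pos powr_mono_both[of 1 1 "u powr (1/k)" v]
        powr_le_cancel_iff
      by (smt (verit) nonzero_mult_div_cancel_left powr_mono2 powr_nonneg_iff powr_one powr_powr powr_ge_zero
          divide_nonneg_pos times_divide_eq_right mult.commute mult_1 atLeastAtMost_iff)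
    then have "{0..1} \<inter> (\<lambda>u. u powr (1 / k)) -` {..v} = {0..v powr k}"
      using v k_pos powr_mono2[of k v 1] by auto
    moreover have "(\<lambda>u. u powr (1 / k)) -` {..v} \<in> sets lborel"
      using measurable_sets[of "\<lambda>u. u powr (1 / k)" lborel borel "{..v}"] by simp
    ultimately show ?thesis
      by (simp add: cdf_def measure_distr)
  qed
  \<comment> \<open>The pushforward is itself an instance of the locale, so \<open>cdf_eq\<close>
    describes both distribution functions on the whole line.\<close>
  interpret D: power_distribution ?D k
    by unfold_locales (use cdfD k_pos in auto)
  show ?thesis
    by (rule cdf_unique)
      (auto intro: real_distribution_axioms D.real_distribution_axioms simp: cdf_eq D.cdf_eq fun_eq_iff)
qed

lemma measure_singleton: "measure P {x} = 0"
proof -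
  let ?U = "uniform_measure lborel {0..1::real}"
  have sets: "(\<lambda>u. u powr (1 / k)) -` {x} \<in> sets lborel"
    using measurable_sets[of "\<lambda>u. u powr (1 / k)" lborel borel "{x}"] by simp
  have "measure P {x} = measure ?U ((\<lambda>u. u powr (1 / k)) -` {x})"
    by (subst P_eq_distr_uniform) (simp add: measure_distr)
  also have "\<dots> = measure lborel ({0..1} \<inter> (\<lambda>u. u powr (1 / k)) -` {x})"
    using sets by simp
  also have "\<dots> = 0"
  proof -
    have "{0..1} \<inter> (\<lambda>u. u powr (1 / k)) -` {x} \<subseteq> {x powr k}"
      using k_pos by (auto simp: powr_powr)
    then have "countable ({0..1} \<inter> (\<lambda>u. u powr (1 / k)) -` {x})"
      by (rule countable_subset) simp
    then show ?thesis by (simp add: measure_def emeasure_lborel_countable)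
  qed
  finally show ?thesis .
qed

lemma measure_Ioc:
  assumes "0 \<le> a" "a \<le> b" "b \<le> 1"
  shows "measure P {a<..b} = b powr k - a powr k"
  using cdf_diff_eq[of a b] cdf_eq_powr[of a] cdf_eq_powr[of b] assms by (cases "a = b") auto

lemma measure_Icc:
  assumes "0 \<le> a" "a \<le> b" "b \<le> 1"
  shows "measure P {a..b} = b powr k - a powr k"
proof -
  have "{a..b} = {a} \<union> {a<..b}" using assms by auto
  then have "measure P {a..b} = measure P {a} + measure P {a<..b}"
    by (simp only:) (rule finite_measure_Union, auto)
  then show ?thesis using measure_Ioc[OF assms] measure_singleton[of a] by simp
qed

lemma measure_Ico:
  assumes "0 \<le> a" "a \<le> b" "b \<le> 1"
  shows "measure P {a..<b} = b powr k - a powr k"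
proof -
  have "{a..b} = {a..<b} \<union> {b}" using assms by auto
  then have "measure P {a..b} = measure P {a..<b} + measure P {b}"
    by (simp only:) (rule finite_measure_Union, auto)
  then show ?thesis using measure_Icc[OF assms] measure_singleton[of b] by simp
qed

text \<open>Substituting \<open>t = u powr (1 / k)\<close> leaves the integral of
  \<open>u powr (1 / k)\<close> from \<open>a powr k\<close> to \<open>b powr k\<close>. Positivity
  of \<open>a\<close> keeps \<open>u\<close> where the power rule for derivatives applies.\<close>

lemma nn_integral_Ioc:
  assumes "0 < a" "a \<le> b" "b \<le> 1"
  shows "(\<integral>\<^sup>+t. ennreal t * indicator {a<..b} t \<partial>P) =
    ennreal (k / (k + 1) * (b powr (k + 1) - a powr (k + 1)))"
proof -
  let ?U = "uniform_measure lborel {0..1::real}"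
  let ?g = "\<lambda>u::real. u powr (1 / k)"
  let ?G = "\<lambda>u::real. k / (k + 1) * u powr (1 / k + 1)"
  have "(\<integral>\<^sup>+t. ennreal t * indicator {a<..b} t \<partial>P) =
      (\<integral>\<^sup>+u. ennreal (?g u) * indicator {a<..b} (?g u) \<partial>?U)"
    by (subst P_eq_distr_uniform) (simp add: nn_integral_distr)
  also have "\<dots> = (\<integral>\<^sup>+u. ennreal (?g u) * indicator {a<..b} (?g u) * indicator {0..1} u \<partial>lborel)"
    by (simp add: nn_integral_uniform_measure divide_ennreal_def)
  also have "\<dots> = (\<integral>\<^sup>+u. ennreal (?g u) * indicator {a powr k..b powr k} u \<partial>lborel)"
  proof (rule nn_integral_cong_AE)
    \<comment> \<open>The two integrands can differ only at \<open>a powr k\<close>, which is mapped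
      to the excluded endpoint \<open>a\<close>.\<close>
    have "?g u \<in> {a<..b} \<and> u \<in> {0..1} \<longleftrightarrow> u \<in> {a powr k..b powr k}" if "u \<noteq> a powr k" for u
    proof
      assume u: "?g u \<in> {a<..b} \<and> u \<in> {0..1}"
      then have "u = ?g u powr k" using k_pos by (simp add: powr_powr)
      moreover have "a powr k \<le> ?g u powr k" "?g u powr k \<le> b powr k"
        using u assms k_pos by (auto intro!: powr_mono2)
      ultimately show "u \<in> {a powr k..b powr k}" by simp
    next
      assume u: "u \<in> {a powr k..b powr k}"
      with that have "a powr k < u" "u \<le> b powr k" by auto
      moreover have "(a powr k) powr (1 / k) = a" "(b powr k) powr (1 / k) = b"
        using assms k_pos by (simp_all add: powr_powr)
      moreover have "b powr k \<le> 1" using assms k_pos by (intro powr_le1) auto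
      ultimately show "?g u \<in> {a<..b} \<and> u \<in> {0..1}"
        using powr_less_mono2[of "1 / k" "a powr k" u] powr_mono2[of "1 / k" u "b powr k"] k_pos
          powr_ge_zero[of a k] by (auto simp del: powr_ge_zero)
    qed
    then have "ennreal (?g u) * indicator {a<..b} (?g u) * indicator {0..1} u =
        ennreal (?g u) * indicator {a powr k..b powr k} u" if "u \<noteq> a powr k" for u
      using that by (auto simp: indicator_def)
    then show "AE u in lborel. ennreal (?g u) * indicator {a<..b} (?g u) * indicator {0..1} u =
        ennreal (?g u) * indicator {a powr k..b powr k} u"
      using AE_lborel_singleton[of "a powr k"] by (auto elim!: eventually_mono)
  qed
  also have "\<dots> = ennreal (?G (b powr k) - ?G (a powr k))"
  proof (rule nn_integral_FTC_Icc)
    fix u assume "u \<in> {a powr k..b powr k}"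
    then have "a powr k \<le> u" by simp
    moreover have "0 < a powr k" using assms(1) by simp
    ultimately have "0 < u" by linarith
    then have "(?G has_real_derivative k / (k + 1) * ((1 / k + 1) * u powr (1 / k))) (at u)"
      using has_real_derivative_powr[of u "1 / k + 1"] by (intro DERIV_cmult) simp
    moreover have "k / (k + 1) * ((1 / k + 1) * u powr (1 / k)) = ?g u"
    proof -
      have "k / (k + 1) * (1 / k + 1) = 1" using k_pos by (simp add: divide_simps)
      then show ?thesis by (metis mult.assoc mult_1)
    qed
    ultimately show "(?G has_real_derivative ?g u) (at u)" by simp
  qed (use assms k_pos in \<open>auto intro!: powr_mono2\<close>)
  also have "?G (b powr k) - ?G (a powr k) = k / (k + 1) * (b powr (k + 1) - a powr (k + 1))"
    using k_pos by (simp add: powr_powr algebra_simps)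
  finally show ?thesis .
qed

end

subsection \<open>Equilibrium prices\<close>

lemma message_space_eq: "message_space 0 1 = {(a, b). 0 \<le> a \<and> a \<le> b \<and> b \<le> 1}"
  by (force simp: message_space_def messages_def)

text \<open>Assumes less than an equilibrium, because it serves both the analysis of equilibria and
  the proof that the greedy assessment obeys Bayes' rule.\<close>

lemma (in real_distribution) set_integrable_belief:
  assumes feasible: "feasible 0 1 \<sigma>" and supported: "beliefs_supported 0 1 \<sigma>"
    and A: "A \<in> sets borel" and J: "J \<in> sets borel" "J \<subseteq> {0..1}"
  shows "set_integrable M J (\<lambda>t. measure (belief \<sigma> (message \<sigma> t)) A)"
proof -
  let ?f = "\<lambda>t. measure (belief \<sigma> (message \<sigma> t)) A"
  have space: "message \<sigma> t \<in> message_space 0 1" if "t \<in> {0..1}" for t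
    using feasible that unfolding feasible_def message_space_def by blast
  have "message \<sigma> \<in> restrict_space borel {0..1} \<rightarrow>\<^sub>M restrict_space borel (message_space 0 1)"
    using feasible space unfolding feasible_def
    by (intro measurable_restrict_space2) (auto simp: space_restrict_space)
  moreover have belief: "belief \<sigma> \<in> restrict_space borel (message_space 0 1) \<rightarrow>\<^sub>M prob_algebra borel"
    using supported unfolding beliefs_supported_def by blast
  ultimately have "(\<lambda>t. belief \<sigma> (message \<sigma> t)) \<in> restrict_space borel {0..1} \<rightarrow>\<^sub>M prob_algebra borel"
    by (rule measurable_compose)
  then have f: "?f \<in> borel_measurable (restrict_space borel {0..1})"
    using A by (rule measurable_compose[OF _ measurable_measure_prob_algebra])
  have "set_integrable M {0..1} ?f"
    unfolding set_integrable_def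
  proof (rule integrable_const_bound[where B = 1])
    show "(\<lambda>t. indicat_real {0..1} t *\<^sub>R ?f t) \<in> borel_measurable M"
      using f by (subst (asm) borel_measurable_restrict_space_iff) auto
    have "?f t \<le> 1" if "t \<in> {0..1}" for t
    proof -
      have "prob_space (belief \<sigma> (message \<sigma> t))"
        using measurable_space[OF belief, of "message \<sigma> t"] space[OF that]
        by (simp add: space_prob_algebra space_restrict_space)
      then show ?thesis by (rule prob_space.prob_le_1)
    qed
    then show "AE t in M. norm (indicat_real {0..1} t *\<^sub>R ?f t) \<le> 1"
      by (auto simp: indicator_def)
  qed
  then show ?thesis by (rule set_integrable_subset) (use J in auto)
qed

locale power_equilibrium = power_distribution P k
  for P :: "real measure" and k :: real +
  fixes \<tau> :: assessment
  assumes equilibrium: "equilibrium P 0 1 \<tau>"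
begin

definition charged :: "real \<Rightarrow> real" where
  "charged t = price \<tau> (message \<tau> t)"

definition effective_price :: "real \<Rightarrow> real" where
  "effective_price t = min t (charged t)"

lemma feasible: "feasible 0 1 \<tau>" and supported: "beliefs_supported 0 1 \<tau>"
  using equilibrium by (auto simp: equilibrium_def)

lemmas equilibrium_unfolded = equilibrium[unfolded equilibrium_def feasible_def beliefs_supported_def
  bayes_consistent_def purchase_rational_def pricing_rational_def disclosure_rational_def]

lemma message_in_messages: "t \<in> {0..1} \<Longrightarrow> message \<tau> t \<in> messages 0 1 t"
  using equilibrium_unfolded by blast

lemma messages_subset: "t \<in> {0..1} \<Longrightarrow> messages 0 1 t \<subseteq> message_space 0 1"
  by (auto simp: message_space_def)

lemma message_in_space: "t \<in> {0..1} \<Longrightarrow> message \<tau> t \<in> message_space 0 1"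
  using message_in_messages messages_subset by blast

lemma buys_iff: "t \<in> {0..1} \<Longrightarrow> m \<in> messages 0 1 t \<Longrightarrow> 0 \<le> q \<Longrightarrow> buys \<tau> t m q \<longleftrightarrow> q \<le> t"
  using equilibrium_unfolded by (smt (verit))

lemma price_nonneg: "m \<in> message_space 0 1 \<Longrightarrow> 0 \<le> price \<tau> m"
  using equilibrium_unfolded by blast

lemma Bayes_rule:
  assumes "A \<in> sets borel" "B \<in> sets borel"
  shows "measure P {t \<in> {0..1}. t \<in> A \<and> message \<tau> t \<in> B} =
    (LINT t:{t \<in> {0..1}. message \<tau> t \<in> B}|P. measure (belief \<tau> (message \<tau> t)) A)"
  using equilibrium assms unfolding equilibrium_def bayes_consistent_def by blast

lemma consumer_payoff_eq:
  assumes "t \<in> {0..1}" "m \<in> messages 0 1 t"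
  shows "consumer_payoff \<tau> t m = t - min t (price \<tau> m)"
  using buys_iff[OF assms, of "price \<tau> m"] price_nonneg[of m] messages_subset[OF assms(1)] assms(2)
  unfolding consumer_payoff_def by (auto simp: min_def)

lemma belief_space:
  assumes "m \<in> message_space 0 1"
  shows "prob_space (belief \<tau> m)" "sets (belief \<tau> m) = sets borel"
proof -
  have "belief \<tau> \<in> restrict_space borel (message_space 0 1) \<rightarrow>\<^sub>M prob_algebra borel"
    using equilibrium_unfolded by blast
  from measurable_space[OF this, of m] assms
  show "prob_space (belief \<tau> m)" "sets (belief \<tau> m) = sets borel"
    by (auto simp: space_prob_algebra space_restrict_space)
qed

text \<open>The belief gives the message interval mass 1, so the buyers inside it can be replaced by
  all types from \<open>q\<close> on.\<close>

lemma expected_revenue_eq: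
  assumes m: "m \<in> message_space 0 1" and q: "0 \<le> q"
  shows "expected_revenue \<tau> m q = q * measure (belief \<tau> m) {q..}"
proof -
  interpret B: prob_space "belief \<tau> m" by (rule belief_space[OF m])
  note [simp] = belief_space(2)[OF m]
  have "{t \<in> {fst m..snd m}. buys \<tau> t m q} = {q..} \<inter> {fst m..snd m}"
    using m q buys_iff[of _ m q] by (force simp: message_space_eq messages_def)
  moreover have "B.prob ({q..} \<inter> {fst m..snd m}) = B.prob {q..}"
  proof (rule measure_eq_AE)
    have "B.prob {fst m..snd m} = 1" using equilibrium_unfolded m by blast
    then have "AE t in belief \<tau> m. t \<in> {fst m..snd m}" by (subst (asm) B.prob_eq_1) auto
    then show "AE t in belief \<tau> m. t \<in> {q..} \<inter> {fst m..snd m} \<longleftrightarrow> t \<in> {q..}" by auto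
  qed auto
  ultimately show ?thesis by (simp add: expected_revenue_def)
qed

lemma price_optimal:
  assumes "m \<in> message_space 0 1" "0 \<le> q"
  shows "q * measure (belief \<tau> m) {q..} \<le> price \<tau> m * measure (belief \<tau> m) {price \<tau> m..}"
  using equilibrium_unfolded expected_revenue_eq[OF assms(1)] assms price_nonneg[OF assms(1)] by metis

text \<open>Charging the lower endpoint sells with certainty, so the optimal revenue is at least
  \<open>fst m\<close>; and revenue never exceeds the price.\<close>

lemma fst_le_price:
  assumes m: "m \<in> message_space 0 1"
  shows "fst m \<le> price \<tau> m"
proof -
  interpret B: prob_space "belief \<tau> m" by (rule belief_space[OF m])
  note [simp] = belief_space(2)[OF m]
  have "B.prob {fst m..snd m} = 1" using equilibrium_unfolded m by blast
  moreover have "B.prob {fst m..snd m} \<le> B.prob {fst m..}" by (rule B.finite_measure_mono) auto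
  ultimately have "B.prob {fst m..} = 1" using B.prob_le_1[of "{fst m..}"] by linarith
  moreover have "0 \<le> fst m" using m by (auto simp: message_space_eq)
  ultimately have "fst m \<le> price \<tau> m * B.prob {price \<tau> m..}"
    using price_optimal[OF m] by fastforce
  also have "\<dots> \<le> price \<tau> m * 1"
    using price_nonneg[OF m] by (intro mult_left_mono) auto
  finally show ?thesis by simp
qed

lemma charged_nonneg: "t \<in> {0..1} \<Longrightarrow> 0 \<le> charged t"
  unfolding charged_def using price_nonneg message_in_space by blast

lemma consumer_payoff_message: "t \<in> {0..1} \<Longrightarrow> consumer_payoff \<tau> t (message \<tau> t) = t - effective_price t"
  unfolding effective_price_def charged_def using consumer_payoff_eq message_in_messages by blast

lemma effective_price_le: "effective_price t \<le> t"
  by (simp add: effective_price_def)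

lemma effective_price_nonneg: "t \<in> {0..1} \<Longrightarrow> 0 \<le> effective_price t"
  using charged_nonneg by (simp add: effective_price_def)

text \<open>A type between the price of a message and its sender can imitate the sender, because the
  price is at least the lower endpoint of the message.\<close>

lemma effective_price_mono:
  assumes "s \<in> {0..1}" "t \<in> {0..1}" "s \<le> t"
  shows "effective_price s \<le> effective_price t"
proof (cases "s \<le> effective_price t")
  case True
  then show ?thesis using effective_price_le[of s] by linarith
next
  case False
  then have c: "effective_price t = charged t" "charged t < s"
    using assms(3) by (auto simp: effective_price_def min_def split: if_splits)
  have "fst (message \<tau> t) \<le> charged t"
    unfolding charged_def using fst_le_price message_in_space assms(2) by blast
  then have m: "message \<tau> t \<in> messages 0 1 s"
    using message_in_messages[OF assms(2)] assms(3) c(2) by (auto simp: messages_def)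
  then have "consumer_payoff \<tau> s (message \<tau> t) \<le> consumer_payoff \<tau> s (message \<tau> s)"
    using equilibrium_unfolded assms(1) by blast
  then show ?thesis
    using consumer_payoff_message[OF assms(1)] consumer_payoff_eq[OF assms(1) m] c
    by (simp add: charged_def)
qed

lemma charged_measurable: "charged \<in> borel_measurable (restrict_space borel {0..1})"
proof -
  have "message \<tau> \<in> restrict_space borel {0..1} \<rightarrow>\<^sub>M restrict_space borel (message_space 0 1)"
    using equilibrium_unfolded message_in_space
    by (intro measurable_restrict_space2) (auto simp: space_restrict_space)
  moreover have "price \<tau> \<in> restrict_space borel (message_space 0 1) \<rightarrow>\<^sub>M borel"
    using equilibrium_unfolded by blast
  ultimately show ?thesis
    unfolding charged_def[abs_def] by (rule measurable_compose)
qed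

lemma charged_sets:
  assumes "S \<in> sets borel"
  shows "{t \<in> {0..1}. charged t \<in> S} \<in> sets borel"
proof -
  have "{t \<in> {0..1}. charged t \<in> S} = charged -` S \<inter> space (restrict_space borel {0..1})"
    by (auto simp: space_restrict_space)
  also have "\<dots> \<in> sets (restrict_space borel {0..1})"
    using charged_measurable assms by (rule measurable_sets)
  finally show ?thesis by (simp add: sets_restrict_space_iff)
qed

text \<open>Optimality of the price after each message, integrated by Bayes' rule over all messages
  priced in \<open>{c..<c'}\<close>. A single message may have probability zero, so messages are
  pooled over a window of prices, at the cost of \<open>c'\<close> in place of the actual
  price.\<close>

lemma deviation_bound:
  assumes q: "0 \<le> q" and c: "0 \<le> c" "c \<le> c'"
  shows "q * measure P {t \<in> {0..1}. q \<le> t \<and> charged t \<in> {c..<c'}} \<le>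
    c' * measure P {t \<in> {0..1}. c \<le> t \<and> charged t \<in> {c..<c'}}"
proof -
  define B where "B = {m \<in> message_space 0 1. price \<tau> m \<in> {c..<c'}}"
  define J where "J = {t \<in> {0..1}. charged t \<in> {c..<c'}}"
  have J: "J \<in> sets borel" unfolding J_def by (rule charged_sets) simp
  have JB: "J = {t \<in> {0..1}. message \<tau> t \<in> B}"
    unfolding J_def B_def charged_def using message_in_space by auto
  \<comment> \<open>Bayes' rule is stated for Borel sets of the plane, so \<open>B\<close> has to be
    Borel there and not only relative to the message space.\<close>
  have "closed (message_space 0 1)"
  proof -
    have "message_space 0 1 = {m. 0 \<le> fst m} \<inter> {m. fst m \<le> snd m} \<inter> {m. snd m \<le> 1}"
      by (auto simp: message_space_eq)
    then show ?thesis by (auto intro!: closed_Int closed_Collect_le continuous_intros)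
  qed
  then have ms: "message_space 0 1 \<in> sets borel" by simp
  have "B = price \<tau> -` {c..<c'} \<inter> space (restrict_space borel (message_space 0 1))"
    by (auto simp: B_def space_restrict_space)
  also have "\<dots> \<in> sets (restrict_space borel (message_space 0 1))"
    using equilibrium_unfolded by (intro measurable_sets[of _ _ borel]) auto
  finally have B: "B \<in> sets borel" using ms by (simp add: sets_restrict_space_iff)
  have bayes: "measure P {t \<in> {0..1}. x \<le> t \<and> charged t \<in> {c..<c'}} =
      (LINT t:J|P. measure (belief \<tau> (message \<tau> t)) {x..})" for x
  proof -
    have "measure P {t \<in> {0..1}. t \<in> {x..} \<and> message \<tau> t \<in> B} =
        (LINT t:{t \<in> {0..1}. message \<tau> t \<in> B}|P. measure (belief \<tau> (message \<tau> t)) {x..})"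
      by (rule Bayes_rule) (simp_all add: B)
    moreover have "{t \<in> {0..1}. t \<in> {x..} \<and> message \<tau> t \<in> B} =
        {t \<in> {0..1}. x \<le> t \<and> charged t \<in> {c..<c'}}"
      unfolding B_def charged_def using message_in_space by auto
    ultimately show ?thesis by (simp add: JB)
  qed
  have "(LINT t:J|P. q * measure (belief \<tau> (message \<tau> t)) {q..}) \<le>
      (LINT t:J|P. c' * measure (belief \<tau> (message \<tau> t)) {c..})"
  proof (rule set_integral_mono)
    fix t assume "t \<in> J"
    then have t: "t \<in> {0..1}" "charged t \<in> {c..<c'}" by (auto simp: J_def)
    note m = message_in_space[OF t(1)]
    interpret T: prob_space "belief \<tau> (message \<tau> t)" by (rule belief_space[OF m])
    have "q * T.prob {q..} \<le> charged t * T.prob {charged t..}"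
      unfolding charged_def by (rule price_optimal[OF m q])
    also have "\<dots> \<le> c' * T.prob {c..}"
      using t c belief_space(2)[OF m] by (intro mult_mono T.finite_measure_mono) auto
    finally show "q * T.prob {q..} \<le> c' * T.prob {c..}" .
  qed (use J in \<open>auto intro!: set_integrable_mult_right set_integrable_belief[OF feasible supported] simp: J_def\<close>)
  then show ?thesis unfolding bayes by simp
qed

end

section \<open>Blocks of types paying a common price\<close>

context power_equilibrium
begin

text \<open>If types below \<open>x\<close> pay less than \<open>c\<close>, then messages priced in \<open>{c..<x}\<close> are only bought by
  types above \<open>x\<close>, and the seller would raise their price to \<open>x\<close>.\<close>

lemma effective_price_gap:
  assumes c: "0 \<le> c" "c < x" "x \<le> 1"
    and below: "\<And>s. s \<in> {0..1} \<Longrightarrow> s < x \<Longrightarrow> effective_price s < c"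
    and above: "\<And>s. s \<in> {0..1} \<Longrightarrow> x < s \<Longrightarrow> c \<le> effective_price s"
    and t: "t \<in> {0..1}" "x < t"
  shows "x \<le> effective_price t"
proof (rule ccontr)
  assume "\<not> x \<le> effective_price t"
  then have "max (effective_price t) c < x" using c by simp
  then obtain c' where c': "effective_price t < c'" "c < c'" "c' < x"
    using dense[of "max (effective_price t) c" x] by auto
  let ?S = "\<lambda>q. {s \<in> {0..1}. q \<le> s \<and> charged s \<in> {c..<c'}}"
  \<comment> \<open>By monotonicity these types all pay a price in the window, which gives the
    pooled messages positive probability.\<close>
  have "{x<..t} \<subseteq> ?S x"
  proof
    fix s assume s: "s \<in> {x<..t}"
    then have s01: "s \<in> {0..1}" using c t by auto
    have "effective_price s < c'" using effective_price_mono[OF s01 t(1)] s c' by auto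
    moreover have "c \<le> effective_price s" using above[OF s01] s by auto
    ultimately show "s \<in> ?S x"
      using s s01 c' by (auto simp: effective_price_def min_def split: if_splits)
  qed
  moreover have S: "?S q \<in> sets borel" for q
  proof -
    have "?S q = {q..} \<inter> {s \<in> {0..1}. charged s \<in> {c..<c'}}" by auto
    then show ?thesis using charged_sets[of "{c..<c'}"] by simp
  qed
  ultimately have "measure P {x<..t} \<le> measure P (?S x)"
    by (intro finite_measure_mono) auto
  moreover have "0 < measure P {x<..t}"
    using measure_Ioc[of x t] c t k_pos powr_less_mono2[of k x t] by auto
  ultimately have pos: "0 < measure P (?S x)" by linarith
  \<comment> \<open>A type below \<open>x\<close> in the left set would have value and charge at
    least \<open>c\<close>, against \<open>below\<close>. So raising the price to \<open>x\<close>
    loses no buyer.\<close>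
  have "?S c = ?S x"
  proof -
    have "x \<le> s" if s: "s \<in> ?S c" for s
    proof (rule ccontr)
      assume "\<not> x \<le> s"
      then have "effective_price s < c" using below s by auto
      with s show False by (auto simp: effective_price_def)
    qed
    then show ?thesis using c by auto
  qed
  then have "x * measure P (?S x) \<le> c' * measure P (?S x)"
    using deviation_bound[of x c c'] c c' by simp
  with pos c' show False by simp
qed

text \<open>\<open>x\<close> is the supremum of the types paying less than \<open>c\<close>, and
  monotonicity places every type below \<open>x\<close> among them. Types above \<open>x\<close> pay
  at least \<open>c\<close>, which \<open>effective_price_gap\<close> improves to
  \<open>x\<close>.\<close>

lemma effective_price_threshold:
  assumes c: "0 \<le> c" and t: "t \<in> {0..1}" "c < t" "effective_price t < c"
  obtains x where "t \<le> x" "x \<le> 1"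
    "\<And>s. s \<in> {0..1} \<Longrightarrow> s < x \<Longrightarrow> effective_price s < c"
    "\<And>s. s \<in> {0..1} \<Longrightarrow> x < s \<Longrightarrow> x \<le> effective_price s"
proof -
  define X where "X = {s \<in> {0..1}. effective_price s < c}"
  have X: "t \<in> X" "bdd_above X" "X \<noteq> {}" using t by (auto simp: X_def bdd_above_def)
  have 1: "t \<le> Sup X" using X by (intro cSup_upper)
  have 2: "Sup X \<le> 1" using X(3) by (intro cSup_least) (auto simp: X_def)
  have 3: "effective_price s < c" if s: "s \<in> {0..1}" "s < Sup X" for s
  proof -
    obtain s' where "s' \<in> X" "s < s'" using less_cSupE[OF s(2) X(3)] by blast
    then show ?thesis using effective_price_mono[of s s'] s by (auto simp: X_def)
  qed
  have 4: "c \<le> effective_price s" if "s \<in> {0..1}" "Sup X < s" for s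
    using cSup_upper[of s X] X(2) that by (force simp: X_def)
  have 5: "Sup X \<le> effective_price s" if "s \<in> {0..1}" "Sup X < s" for s
    using effective_price_gap[of c "Sup X" s] c 1 2 3 4 t that by auto
  show thesis using that[OF 1 2 3 5] by blast
qed

text \<open>The clause on \<open>{b<..1}\<close> makes the block maximal to the right, so that
  overlapping blocks coincide. The endpoints \<open>a\<close> and \<open>b\<close> themselves are
  left open.\<close>

definition block :: "real \<times> real \<Rightarrow> bool" where
  "block I \<longleftrightarrow> (case I of (a, b) \<Rightarrow> 0 < a \<and> a < b \<and> b \<le> 1 \<and> ratio * b \<le> a \<and>
     (\<forall>s\<in>{a<..<b}. effective_price s = a) \<and> (\<forall>s\<in>{b<..1}. b \<le> effective_price s))"

text \<open>Otherwise, on the messages priced near \<open>a\<close>, raising the price to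
  \<open>ratio * b\<close> would pay: it beats what those messages can earn from
  \<open>{a..b}\<close>. Since \<open>a = 0\<close> is allowed, the conclusion also shows that the
  bottom of a block is positive.\<close>

lemma block_bottom_ge:
  assumes ab: "0 \<le> a" "a < b" "b \<le> 1"
    and const: "\<And>s. s \<in> {a<..<b} \<Longrightarrow> effective_price s = a"
    and above: "\<And>s. s \<in> {b<..1} \<Longrightarrow> b \<le> effective_price s"
  shows "ratio * b \<le> a"
proof (rule ccontr)
  assume "\<not> ratio * b \<le> a"
  then have lt: "a < ratio * b" by simp
  have rb: "ratio * b < b" using ratio_less_1 ab by simp
  let ?R = "ratio * b * (b powr k - (ratio * b) powr k)"
  let ?D = "b powr k - a powr k"
  have "a * ?D < ?R"
    using revenue_less_ratio[of a b] ab lt by simp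
  moreover have "0 < ?D" using powr_less_mono2[of k a b] k_pos ab by simp
  ultimately have "a < ?R / ?D" by (simp add: pos_less_divide_eq)
  \<comment> \<open>\<open>c\<close> closes the price window; the last bound keeps
    \<open>c * ?D\<close> below the monopoly revenue \<open>?R\<close>.\<close>
  then obtain c where c: "a < c" "c < b" "c < ?R / ?D"
    using dense[of a "min b (?R / ?D)"] ab by auto
  let ?S = "\<lambda>q. {s \<in> {0..1}. q \<le> s \<and> charged s \<in> {a..<c}}"
  have S: "?S q \<in> sets borel" for q
  proof -
    have "?S q = {q..} \<inter> {s \<in> {0..1}. charged s \<in> {a..<c}}" by auto
    then show ?thesis using charged_sets[of "{a..<c}"] by simp
  qed
  have sub: "{ratio * b..<b} \<subseteq> ?S (ratio * b)"
  proof
    fix s assume s: "s \<in> {ratio * b..<b}"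
    then have "effective_price s = a" "a < s" using const[of s] lt by auto
    then have "charged s = a" by (auto simp: effective_price_def min_def split: if_splits)
    then show "s \<in> ?S (ratio * b)" using s ab lt c by auto
  qed
  have "b powr k - (ratio * b) powr k \<le> measure P (?S (ratio * b))"
  proof -
    have "measure P {ratio * b..<b} \<le> measure P (?S (ratio * b))"
      using sub S by (intro finite_measure_mono) auto
    then show ?thesis using measure_Ico[of "ratio * b" b] ab lt rb by linarith
  qed
  then have "?R \<le> ratio * b * measure P (?S (ratio * b))"
    using ab lt by (intro mult_left_mono) auto
  also have "\<dots> \<le> c * measure P (?S a)"
    using deviation_bound[of "ratio * b" a c] ab lt c by simp
  also have "\<dots> \<le> c * ?D"
  proof -
    \<comment> \<open>Types above \<open>b\<close> pay at least \<open>b > c\<close>, so they are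
      not charged a price in the window.\<close>
    have "s \<le> b" if "s \<in> ?S a" for s
      using that above[of s] c by (cases "s \<le> b") (auto simp: effective_price_def)
    then have "?S a \<subseteq> {a..b}" by auto
    then have "measure P (?S a) \<le> measure P {a..b}" by (intro finite_measure_mono) auto
    then show ?thesis using measure_Icc[of a b] ab c by (intro mult_left_mono) auto
  qed
  also have "\<dots> < ?R" using c \<open>0 < ?D\<close> by (simp add: pos_less_divide_eq)
  finally show False by simp
qed

text \<open>The bottom is the effective price of \<open>q\<close>; the top is the threshold for a
  level \<open>c0\<close> strictly between \<open>effective_price t\<close> and \<open>q\<close>.
  Constancy in between comes from comparing this threshold with those for levels near
  \<open>a\<close>.\<close>

lemma block_exists:
  assumes q: "q \<in> {0..1}" and t: "t \<in> {0..1}" "q < t" "effective_price t < q"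
  shows "\<exists>a b. block (a, b) \<and> a < q \<and> t \<le> b"
proof -
  define a where "a = effective_price q"
  have aq: "a < q" "0 \<le> a"
    using effective_price_mono[OF q t(1)] t effective_price_nonneg[OF q] by (auto simp: a_def)
  obtain c0 where c0: "effective_price t < c0" "c0 < q" using dense[OF t(3)] by blast
  have "0 \<le> c0" using effective_price_nonneg[OF t(1)] c0 by linarith
  then obtain b where b: "t \<le> b" "b \<le> 1"
    "\<And>s. s \<in> {0..1} \<Longrightarrow> s < b \<Longrightarrow> effective_price s < c0"
    "\<And>s. s \<in> {0..1} \<Longrightarrow> b < s \<Longrightarrow> b \<le> effective_price s"
    using effective_price_threshold[of c0 t] t c0 by auto
  have le: "effective_price s \<le> a" if s: "s \<in> {0..1}" "s < b" for s
  proof (rule field_le_epsilon)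
    fix e :: real assume "0 < e"
    then obtain c where c: "a < c" "c < q" "c < a + e"
      using dense[of a "min q (a + e)"] aq by auto
    obtain x where x: "q \<le> x" "x \<le> 1"
      "\<And>s. s \<in> {0..1} \<Longrightarrow> s < x \<Longrightarrow> effective_price s < c"
      "\<And>s. s \<in> {0..1} \<Longrightarrow> x < s \<Longrightarrow> x \<le> effective_price s"
      using effective_price_threshold[of c q] q c aq by (auto simp: a_def)
    \<comment> \<open>A type between \<open>x\<close> and \<open>b\<close> would pay at least
      \<open>x\<close>, hence at least \<open>q\<close>, but also less than
      \<open>c0 < q\<close>.\<close>
    have "b \<le> x"
    proof (rule ccontr)
      assume "\<not> b \<le> x"
      then obtain u where u: "x < u" "u < b" using dense[of x b] by auto
      then have "u \<in> {0..1}" using x q b by auto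
      then show False using x(4)[of u] b(3)[of u] u x(1) c0 by auto
    qed
    then show "effective_price s \<le> a + e" using x(3)[of s] s c by auto
  qed
  have ge: "a \<le> effective_price s" if s: "a < s" "s < b" for s
  proof (rule ccontr)
    assume "\<not> a \<le> effective_price s"
    moreover have s01: "s \<in> {0..1}" using s b aq by auto
    ultimately obtain c where c: "effective_price s < c" "c < a"
      using dense[of "effective_price s" a] by auto
    have "0 \<le> c" using effective_price_nonneg[OF s01] c by simp
    then obtain x where x: "s \<le> x" "x \<le> 1"
      "\<And>s. s \<in> {0..1} \<Longrightarrow> s < x \<Longrightarrow> effective_price s < c"
      "\<And>s. s \<in> {0..1} \<Longrightarrow> x < s \<Longrightarrow> x \<le> effective_price s"
      using effective_price_threshold[of c s] s01 s c by auto
    \<comment> \<open>If \<open>q < x\<close>, then \<open>q\<close> would pay less than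
      \<open>c < a\<close>; if \<open>x < q\<close>, it would pay at least
      \<open>x \<ge> s > a\<close>. If \<open>q = x\<close>, types just above \<open>q\<close> would
      pay at least \<open>q > a\<close>, against \<open>le\<close>.\<close>
    have "q = x"
      using x(3)[OF q] x(4)[OF q] c x(1) s by (cases q x rule: linorder_cases) (auto simp: a_def)
    moreover obtain u where u: "q < u" "u < b" using dense[of q b] t b by auto
    moreover have "u \<in> {0..1}" using u b q by auto
    ultimately show False using x(4)[of u] le[of u] aq by auto
  qed
  have const: "effective_price s = a" if "s \<in> {a<..<b}" for s
    using le[of s] ge[of s] that aq b by auto
  have rb: "ratio * b \<le> a"
    using block_bottom_ge[of a b] aq b const t by auto
  moreover have "0 < ratio * b" using ratio_pos b t aq by auto
  ultimately have "0 < a" by linarith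
  then have "block (a, b)"
    unfolding block_def using rb aq b const t by auto
  then show ?thesis using aq b by blast
qed

text \<open>Overlapping blocks share an interior type, whose price forces equal bottoms. If the tops
  differed, a type between them would pay both the common bottom and at least the smaller
  top.\<close>

lemma blocks_disjoint:
  assumes "block (a, b)" "block (a', b')" "s \<in> {a<..b}" "s \<in> {a'<..b'}"
  shows "(a, b) = (a', b')"
proof -
  have ab: "a < b" "b \<le> 1" "0 < a" "\<And>s. s \<in> {a<..<b} \<Longrightarrow> effective_price s = a"
    "\<And>s. s \<in> {b<..1} \<Longrightarrow> b \<le> effective_price s"
    and ab': "a' < b'" "b' \<le> 1" "0 < a'" "\<And>s. s \<in> {a'<..<b'} \<Longrightarrow> effective_price s = a'"
    "\<And>s. s \<in> {b'<..1} \<Longrightarrow> b' \<le> effective_price s"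
    using assms(1,2) unfolding block_def by auto
  have "max a a' < min b b'" using assms(3,4) by auto
  then obtain u where u: "max a a' < u" "u < min b b'" using dense by blast
  then have a: "a = a'" using ab(4)[of u] ab'(4)[of u] by auto
  moreover have "b = b'"
  proof (cases b b' rule: linorder_cases)
    case less
    then obtain u where "b < u" "u < b'" using dense by blast
    then show ?thesis using ab(1) ab'(2) ab(5)[of u] ab'(4)[of u] a by auto
  next
    case greater
    then obtain u where "b' < u" "u < b" using dense by blast
    then show ?thesis using ab'(1) ab(2) ab'(5)[of u] ab(4)[of u] a by auto
  qed
  ultimately show ?thesis by simp
qed

lemma countable_blocks: "countable (Collect block)"
proof -
  have "\<exists>q\<in>\<rat>. fst I < q \<and> q \<le> snd I" if "block I" for I
  proof -
    have "fst I < snd I" using that by (auto simp: block_def)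
    from Rats_dense_in_real[OF this] show ?thesis by (auto intro: less_imp_le)
  qed
  then obtain q where q: "\<And>I. block I \<Longrightarrow> q I \<in> \<rat> \<and> fst I < q I \<and> q I \<le> snd I" by metis
  have "inj_on q (Collect block)"
  proof (rule inj_onI)
    fix I J assume "I \<in> Collect block" "J \<in> Collect block" "q I = q J"
    then show "I = J"
      using q[of I] q[of J] blocks_disjoint[of "fst I" "snd I" "fst J" "snd J" "q I"] by auto
  qed
  moreover have "countable (q ` Collect block)"
    by (rule countable_subset[OF _ countable_rat]) (use q in auto)
  ultimately show ?thesis by (rule countable_image_inj_on[rotated])
qed

text \<open>A type with positive surplus lies in the block that \<open>block_exists\<close> yields
  for any \<open>q\<close> between her effective price and her value.\<close>

lemma effective_price_outside_blocks:
  assumes "t \<in> {0..1}" "\<And>a b. block (a, b) \<Longrightarrow> t \<notin> {a<..b}"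
  shows "effective_price t = t"
proof (rule ccontr)
  assume "effective_price t \<noteq> t"
  then have "effective_price t < t" using effective_price_le[of t] by simp
  then obtain q where q: "effective_price t < q" "q < t" using dense by blast
  moreover have "q \<in> {0..1}" using q effective_price_nonneg[OF assms(1)] assms(1) by auto
  ultimately obtain a b where "block (a, b)" "a < q" "t \<le> b" using block_exists assms(1) by blast
  then show False using assms(2)[of a b] q by auto
qed

text \<open>Monotonicity extends the bound to the top endpoint, where \<open>block\<close>
  prescribes no price.\<close>

lemma effective_price_ge_on_block:
  assumes "block (a, b)" "s \<in> {a<..b}"
  shows "a \<le> effective_price s"
proof -
  have ab: "a < b" "b \<le> 1" "0 < a" "\<And>s. s \<in> {a<..<b} \<Longrightarrow> effective_price s = a"
    using assms(1) unfolding block_def by auto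
  obtain u where u: "a < u" "u < s" using dense[of a s] assms(2) by auto
  then show ?thesis
    using ab(4)[of u] effective_price_mono[of u s] ab assms(2) by auto
qed

end

subsection \<open>The consumer-optimal payoff\<close>

text \<open>Countable additivity of the measure \<open>density M h\<close>. It is applied to the
  blocks of an arbitrary equilibrium and to the greedy segments.\<close>

lemma nn_integral_mono_countable_partition:
  assumes "countable I" "disjoint_family_on X I" "\<And>i. i \<in> I \<Longrightarrow> X i \<in> sets M"
    and f[measurable]: "f \<in> borel_measurable M" and g[measurable]: "g \<in> borel_measurable M"
    and le: "\<And>i. i \<in> I \<Longrightarrow> (\<integral>\<^sup>+x. f x * indicator (X i) x \<partial>M) \<le> (\<integral>\<^sup>+x. g x * indicator (X i) x \<partial>M)"
    and outside: "\<And>x. x \<in> space M \<Longrightarrow> x \<notin> (\<Union>i\<in>I. X i) \<Longrightarrow> f x \<le> g x"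
  shows "integral\<^sup>N M f \<le> integral\<^sup>N M g"
proof -
  let ?U = "\<Union>i\<in>I. X i"
  have U[measurable]: "?U \<in> sets M" using assms(1,3) by (intro sets.countable_UN') auto
  have split: "integral\<^sup>N M h =
      (\<integral>\<^sup>+i. (\<integral>\<^sup>+x. h x * indicator (X i) x \<partial>M) \<partial>count_space I) +
      (\<integral>\<^sup>+x. h x * indicator (space M - ?U) x \<partial>M)" if [measurable]: "h \<in> borel_measurable M" for h
  proof -
    have "integral\<^sup>N M h = emeasure (density M h) (?U \<union> (space M - ?U))"
      using sets.sets_into_space[OF U] by (simp add: emeasure_density Un_absorb1 cong: nn_integral_cong)
    also have "\<dots> = emeasure (density M h) ?U + emeasure (density M h) (space M - ?U)"
      by (rule plus_emeasure[symmetric]) auto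
    also have "emeasure (density M h) ?U = (\<integral>\<^sup>+i. emeasure (density M h) (X i) \<partial>count_space I)"
      using assms(1-3) by (intro emeasure_UN_countable) auto
    also have "\<dots> = (\<integral>\<^sup>+i. (\<integral>\<^sup>+x. h x * indicator (X i) x \<partial>M) \<partial>count_space I)"
      using assms(3) by (intro nn_integral_cong) (simp add: emeasure_density)
    finally show ?thesis by (simp add: emeasure_density)
  qed
  show ?thesis
    unfolding split[OF f] split[OF g]
  proof (rule add_mono; rule nn_integral_mono)
    fix x assume "x \<in> space M"
    then show "f x * indicator (space M - ?U) x \<le> g x * indicator (space M - ?U) x"
      using outside[of x] by (auto simp: indicator_def)
  qed (use le in simp)
qed

context power_distribution
begin

lemma nn_integral_price_share_Ioc:
  assumes "0 < a" "a \<le> b" "b \<le> 1"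
  shows "(\<integral>\<^sup>+t. ennreal (indicat_real {0..1} t * (price_share * t)) * indicator {a<..b} t \<partial>P) =
    ennreal (price_share * (k / (k + 1) * (b powr (k + 1) - a powr (k + 1))))"
proof -
  have "(\<integral>\<^sup>+t. ennreal (indicat_real {0..1} t * (price_share * t)) * indicator {a<..b} t \<partial>P) =
      (\<integral>\<^sup>+t. ennreal price_share * (ennreal t * indicator {a<..b} t) \<partial>P)"
    using assms price_share_pos by (intro nn_integral_cong) (auto simp: indicator_def ennreal_mult')
  also have "\<dots> = ennreal price_share * (\<integral>\<^sup>+t. ennreal t * indicator {a<..b} t \<partial>P)"
    by (rule nn_integral_cmult) simp
  finally show ?thesis
    unfolding nn_integral_Ioc[OF assms] using price_share_pos by (subst ennreal_mult') auto
qed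

lemma nn_integral_const_Ioc:
  assumes "0 < a" "a \<le> b" "b \<le> 1"
  shows "(\<integral>\<^sup>+t. ennreal (indicat_real {0..1} t * a) * indicator {a<..b} t \<partial>P) =
    ennreal (a * (b powr k - a powr k))"
proof -
  have "(\<integral>\<^sup>+t. ennreal (indicat_real {0..1} t * a) * indicator {a<..b} t \<partial>P) =
      (\<integral>\<^sup>+t. ennreal a * indicator {a<..b} t \<partial>P)"
    using assms by (intro nn_integral_cong) (auto simp: indicator_def)
  also have "\<dots> = ennreal a * emeasure P {a<..b}"
    by (rule nn_integral_cmult_indicator) simp
  finally show ?thesis
    using measure_Ioc[of a b] assms by (simp add: emeasure_eq_measure ennreal_mult')
qed

lemma set_integrable_bounded:
  fixes f :: "real \<Rightarrow> real"
  assumes "f \<in> borel_measurable (restrict_space borel {0..1})" "\<And>t. t \<in> {0..1} \<Longrightarrow> 0 \<le> f t \<and> f t \<le> 1"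
  shows "set_integrable P {0..1} f"
  unfolding set_integrable_def
proof (rule integrable_const_bound[where B = 1])
  show "(\<lambda>t. indicat_real {0..1} t *\<^sub>R f t) \<in> borel_measurable P"
    using assms(1) by (subst (asm) borel_measurable_restrict_space_iff) auto
  show "AE t in P. norm (indicat_real {0..1} t *\<^sub>R f t) \<le> 1"
    using assms(2) by (auto simp: indicator_def)
qed

lemma set_integral_mono_nn_integral:
  fixes f g :: "real \<Rightarrow> real"
  assumes "f \<in> borel_measurable (restrict_space borel {0..1})" "\<And>t. t \<in> {0..1} \<Longrightarrow> 0 \<le> f t \<and> f t \<le> 1"
    and "g \<in> borel_measurable (restrict_space borel {0..1})" "\<And>t. t \<in> {0..1} \<Longrightarrow> 0 \<le> g t \<and> g t \<le> 1"
    and le: "(\<integral>\<^sup>+t. ennreal (indicat_real {0..1} t * f t) \<partial>P) \<le> (\<integral>\<^sup>+t. ennreal (indicat_real {0..1} t * g t) \<partial>P)"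
  shows "(LINT t:{0..1}|P. f t) \<le> (LINT t:{0..1}|P. g t)"
proof -
  have nn: "(\<integral>\<^sup>+t. ennreal (indicat_real {0..1} t * h t) \<partial>P) = ennreal (LINT t:{0..1}|P. h t)"
    if "h \<in> borel_measurable (restrict_space borel {0..1})" "\<And>t. t \<in> {0..1} \<Longrightarrow> 0 \<le> h t \<and> h t \<le> 1"
    for h :: "real \<Rightarrow> real"
    using nn_integral_eq_integral[OF set_integrable_bounded[OF that, unfolded set_integrable_def]] that(2)
    by (auto simp: set_lebesgue_integral_def indicator_def)
  have "0 \<le> (LINT t:{0..1}|P. g t)"
    using assms(4) unfolding set_lebesgue_integral_def by (intro integral_nonneg_AE) (auto simp: indicator_def)
  then show ?thesis
    using le nn[OF assms(1,2)] nn[OF assms(3,4)] by (simp add: ennreal_le_iff)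
qed

lemma price_share_bounds: "t \<in> {0..1} \<Longrightarrow> 0 \<le> price_share * t \<and> price_share * t \<le> 1"
  using price_share_pos price_share_le_1 mult_mono[of price_share 1 t 1] by auto

end

section \<open>Lower bound on the expected price in equilibrium\<close>

context power_equilibrium
begin

lemma effective_price_measurable: "effective_price \<in> borel_measurable (restrict_space borel {0..1})"
  unfolding effective_price_def[abs_def] using charged_measurable
  by (intro borel_measurable_min) (auto intro: measurable_restrict_space1)

lemma effective_price_bounds: "t \<in> {0..1} \<Longrightarrow> 0 \<le> effective_price t \<and> effective_price t \<le> 1"
  using effective_price_nonneg[of t] effective_price_le[of t] by auto

lemma effective_price_ennreal_measurable:
  "(\<lambda>t. ennreal (indicat_real {0..1} t * effective_price t)) \<in> borel_measurable P"
  using effective_price_measurable by (subst (asm) borel_measurable_restrict_space_iff) auto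

text \<open>On a block the bound is \<open>block_price_ge\<close>; outside the blocks types pay
  their full value and \<open>price_share \<le> 1\<close> suffices.\<close>

lemma expected_price_ge:
  "(LINT t:{0..1}|P. price_share * t) \<le> (LINT t:{0..1}|P. effective_price t)"
proof (rule set_integral_mono_nn_integral)
  show "(\<integral>\<^sup>+t. ennreal (indicat_real {0..1} t * (price_share * t)) \<partial>P) \<le>
      (\<integral>\<^sup>+t. ennreal (indicat_real {0..1} t * effective_price t) \<partial>P)"
  proof (rule nn_integral_mono_countable_partition)
    show "countable (Collect block)" by (rule countable_blocks)
    show "disjoint_family_on (\<lambda>I. {fst I<..snd I}) (Collect block)"
      using blocks_disjoint unfolding disjoint_family_on_def
      by (metis disjoint_iff mem_Collect_eq prod.collapse)
    fix I assume "I \<in> Collect block"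
    then obtain a b where I: "I = (a, b)" and block: "block (a, b)" by (cases I) auto
    then have ab: "0 < a" "a < b" "b \<le> 1" "ratio * b \<le> a" by (auto simp: block_def)
    have "(\<integral>\<^sup>+t. ennreal (indicat_real {0..1} t * (price_share * t)) * indicator {a<..b} t \<partial>P) \<le>
        ennreal (a * (b powr k - a powr k))"
      using nn_integral_price_share_Ioc[of a b] block_price_ge[of b a] ab by (simp add: ennreal_leI)
    also have "\<dots> = (\<integral>\<^sup>+t. ennreal (indicat_real {0..1} t * a) * indicator {a<..b} t \<partial>P)"
      using nn_integral_const_Ioc[of a b] ab by simp
    also have "\<dots> \<le> (\<integral>\<^sup>+t. ennreal (indicat_real {0..1} t * effective_price t) * indicator {a<..b} t \<partial>P)"
      using effective_price_ge_on_block[OF block]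
      by (intro nn_integral_mono) (auto simp: indicator_def ennreal_leI)
    finally show "(\<integral>\<^sup>+t. ennreal (indicat_real {0..1} t * (price_share * t)) * indicator {fst I<..snd I} t \<partial>P) \<le>
        (\<integral>\<^sup>+t. ennreal (indicat_real {0..1} t * effective_price t) * indicator {fst I<..snd I} t \<partial>P)"
      by (simp add: I)
  next
    fix t assume t: "t \<notin> (\<Union>I\<in>Collect block. {fst I<..snd I})"
    have "price_share * t \<le> effective_price t" if t01: "t \<in> {0..1}"
    proof -
      have "effective_price t = t"
        using t by (intro effective_price_outside_blocks t01) force
      then show ?thesis
        using t01 price_share_le_1 mult_right_mono[of price_share 1 t] by auto
    qed
    then show "ennreal (indicat_real {0..1} t * (price_share * t)) \<le>
        ennreal (indicat_real {0..1} t * effective_price t)"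
      by (auto simp: indicator_def ennreal_leI)
  qed (auto intro: effective_price_ennreal_measurable)
qed (use effective_price_measurable effective_price_bounds price_share_bounds in
    \<open>auto intro: measurable_restrict_space1\<close>)

lemma ex_ante_consumer_payoff_eq:
  "ex_ante_consumer_payoff P 0 1 \<tau> = (LINT t:{0..1}|P. t) - (LINT t:{0..1}|P. effective_price t)"
proof -
  have "ex_ante_consumer_payoff P 0 1 \<tau> = (LINT t:{0..1}|P. t - effective_price t)"
    unfolding ex_ante_consumer_payoff_def
    by (rule set_lebesgue_integral_cong) (auto simp: consumer_payoff_message)
  also have "\<dots> = (LINT t:{0..1}|P. t) - (LINT t:{0..1}|P. effective_price t)"
    using effective_price_measurable effective_price_bounds
    by (intro set_integral_diff set_integrable_bounded) (auto intro: measurable_restrict_space1)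
  finally show ?thesis .
qed

end

section \<open>Explicit form of the greedy segmentation\<close>

context power_distribution
begin

lemma ratio_power_bounds: "0 < ratio ^ n" "ratio ^ n \<le> 1" "ratio ^ Suc n < ratio ^ n"
  using ratio_pos ratio_less_1 by (auto simp: power_le_one)

lemma ratio_power_antimono: "m \<le> n \<Longrightarrow> ratio ^ n \<le> ratio ^ m"
  using ratio_pos ratio_less_1 by (intro power_decreasing) auto

lemma ratio_segment_exists:
  assumes "0 < t" "t \<le> 1"
  obtains n where "t \<in> {ratio ^ Suc n<..ratio ^ n}"
proof -
  define m where "m = (LEAST m. ratio ^ m < t)"
  have "\<exists>m. ratio ^ m < t" using real_arch_pow_inv assms(1) ratio_less_1 by blast
  then have m: "ratio ^ m < t" unfolding m_def by (rule LeastI_ex)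
  then obtain n where n: "m = Suc n" using assms(2) by (cases m) auto
  have "\<not> ratio ^ n < t" using not_less_Least[of n "\<lambda>m. ratio ^ m < t"] n by (simp add: m_def)
  then show thesis using that[of n] m n by auto
qed

lemma ratio_segment_unique:
  assumes "t \<in> {ratio ^ Suc m<..ratio ^ m}" "t \<in> {ratio ^ Suc n<..ratio ^ n}"
  shows "m = n"
proof (rule ccontr)
  assume "m \<noteq> n"
  then consider "Suc m \<le> n" | "Suc n \<le> m" by linarith
  then show False
    using assms ratio_power_antimono[of "Suc m" n] ratio_power_antimono[of "Suc n" m]
    by cases auto
qed

text \<open>The monopoly price is the only maximizer, so taking the lowest one is harmless. All
  powers of \<open>ratio\<close> are positive, so the procedure never halts.\<close>

lemma greedy_price_eq: "greedy_price (cdf P) 0 1 s = ratio ^ s"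
proof (induction s)
  case (Suc s)
  define d where "d = ratio ^ s"
  have d: "0 < d" "d \<le> 1" unfolding d_def by (rule ratio_power_bounds)+
  have rd: "0 < ratio * d" "ratio * d \<le> 1"
    using d ratio_pos ratio_less_1 mult_le_one[of ratio d] by auto
  have less: "p * (cdf P d - cdf P p) < ratio * d * (cdf P d - cdf P (ratio * d))"
    if "0 \<le> p" "p \<noteq> ratio * d" for p
  proof (cases "p \<le> 1")
    case True
    then show ?thesis using revenue_less_ratio[OF that(1) d(1) that(2)] that d rd by (simp add: cdf_eq_powr)
  next
    case False
    then have "p * (cdf P d - cdf P p) \<le> 0"
      using cdf_nondecreasing[of d p] d by (intro mult_nonneg_nonpos) auto
    also have "0 < ratio * d * (cdf P d - cdf P (ratio * d))"
      using revenue_less_ratio[of 0 d] d rd ratio_pos by (simp add: cdf_eq_powr)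
    finally show ?thesis .
  qed
  have "is_arg_max (\<lambda>p. p * (cdf P d - cdf P p)) (\<lambda>p. 0 \<le> p) p \<longleftrightarrow> p = ratio * d" for p
    using less rd(1) unfolding is_arg_max_def by (metis less_le_not_le not_less)
  then have "(LEAST p. is_arg_max (\<lambda>p. p * (cdf P d - cdf P p)) (\<lambda>p. 0 \<le> p) p) = ratio * d"
    by (intro Least_equality) auto
  then show ?case using Suc.IH d(1) by (simp add: d_def)
qed simp

lemma greedy_segmentation_iff:
  "greedy_segmentation (cdf P) 0 1 \<sigma> \<longleftrightarrow>
    (\<forall>n t. t \<in> {ratio ^ Suc n<..ratio ^ n} \<longrightarrow>
      message \<sigma> t = (ratio ^ Suc n, ratio ^ n) \<and> price \<sigma> (message \<sigma> t) = ratio ^ Suc n \<and>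
      buys \<sigma> t (message \<sigma> t) (price \<sigma> (message \<sigma> t))) \<and>
    message \<sigma> 0 = (0, 0) \<and> price \<sigma> (0, 0) = 0"
  unfolding greedy_segmentation_def greedy_price_eq by auto

end

section \<open>Expected price in the greedy segmentation\<close>

context power_equilibrium
begin

text \<open>Each greedy segment attains equality by \<open>block_price_eq\<close>; only type 0 lies
  outside the segments, and her value and price are both 0.\<close>

lemma greedy_expected_price_le:
  assumes "greedy_segmentation (cdf P) 0 1 \<tau>"
  shows "(LINT t:{0..1}|P. effective_price t) \<le> (LINT t:{0..1}|P. price_share * t)"
proof (rule set_integral_mono_nn_integral)
  have eff: "effective_price t = ratio ^ Suc n" if "t \<in> {ratio ^ Suc n<..ratio ^ n}" for n t
    using assms that unfolding greedy_segmentation_iff effective_price_def charged_def by fastforce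
  show "(\<integral>\<^sup>+t. ennreal (indicat_real {0..1} t * effective_price t) \<partial>P) \<le>
      (\<integral>\<^sup>+t. ennreal (indicat_real {0..1} t * (price_share * t)) \<partial>P)"
  proof (rule nn_integral_mono_countable_partition)
    show "disjoint_family_on (\<lambda>n. {ratio ^ Suc n<..ratio ^ n}) UNIV"
      using ratio_segment_unique unfolding disjoint_family_on_def by blast
    fix n
    have r: "0 < ratio ^ Suc n" "ratio ^ Suc n \<le> ratio ^ n" "ratio ^ n \<le> 1" "0 < ratio ^ n"
      using ratio_power_bounds(3)[of n] ratio_power_bounds(1,2)[of n] ratio_power_bounds(1)[of "Suc n"]
      by (simp_all only: less_imp_le)
    have "(\<integral>\<^sup>+t. ennreal (indicat_real {0..1} t * effective_price t) * indicator {ratio ^ Suc n<..ratio ^ n} t \<partial>P) =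
        (\<integral>\<^sup>+t. ennreal (indicat_real {0..1} t * ratio ^ Suc n) * indicator {ratio ^ Suc n<..ratio ^ n} t \<partial>P)"
      using eff[of _ n] by (intro nn_integral_cong) (auto simp: indicator_def simp del: power_Suc)
    also have "\<dots> = (\<integral>\<^sup>+t. ennreal (indicat_real {0..1} t * (price_share * t)) * indicator {ratio ^ Suc n<..ratio ^ n} t \<partial>P)"
      unfolding nn_integral_const_Ioc[OF r(1-3)] nn_integral_price_share_Ioc[OF r(1-3)]
      using block_price_eq[OF r(4)] by simp
    finally show "(\<integral>\<^sup>+t. ennreal (indicat_real {0..1} t * effective_price t) * indicator {ratio ^ Suc n<..ratio ^ n} t \<partial>P) \<le>
      (\<integral>\<^sup>+t. ennreal (indicat_real {0..1} t * (price_share * t)) * indicator {ratio ^ Suc n<..ratio ^ n} t \<partial>P)"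
      by simp
  next
    fix t assume "t \<notin> (\<Union>n. {ratio ^ Suc n<..ratio ^ n})"
    then have "effective_price t = 0 \<and> t = 0" if "t \<in> {0..1}"
      using ratio_segment_exists[of t] that effective_price_nonneg[of t] effective_price_le[of t]
      by (cases "t = 0") force+
    then show "ennreal (indicat_real {0..1} t * effective_price t) \<le>
        ennreal (indicat_real {0..1} t * (price_share * t))"
      by (auto simp: indicator_def)
  qed (auto intro: effective_price_ennreal_measurable)
qed (use effective_price_measurable effective_price_bounds price_share_bounds in
    \<open>auto intro: measurable_restrict_space1\<close>)

end

lemma (in power_distribution) greedy_consumer_optimal:
  assumes "equilibrium P 0 1 \<sigma>" "greedy_segmentation (cdf P) 0 1 \<sigma>"
  shows "consumer_optimal_equilibrium P 0 1 \<sigma>"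
  unfolding consumer_optimal_equilibrium_def
proof (intro conjI allI impI)
  fix \<tau> assume "equilibrium P 0 1 \<tau>"
  then interpret T: power_equilibrium P k \<tau> by unfold_locales
  interpret S: power_equilibrium P k \<sigma> using assms(1) by unfold_locales
  show "ex_ante_consumer_payoff P 0 1 \<tau> \<le> ex_ante_consumer_payoff P 0 1 \<sigma>"
    using T.ex_ante_consumer_payoff_eq S.ex_ante_consumer_payoff_eq T.expected_price_ge
      S.greedy_expected_price_le[OF assms(2)] by linarith
qed (rule assms(1))

subsection \<open>Existence of the greedy equilibrium\<close>

context power_distribution
begin

text \<open>The base is below 1, so \<open>t\<close> lies between \<open>ratio ^ Suc n\<close>
  (excluded) and \<open>ratio ^ n\<close> iff the floor of the logarithm is \<open>n\<close>. The
  closed formula gives measurability directly.\<close>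

definition segment_top :: "real \<Rightarrow> real" where
  "segment_top t = ratio powr real_of_int \<lfloor>log ratio t\<rfloor>"

definition greedy_messages :: "(real \<times> real) set" where
  "greedy_messages = range (\<lambda>n. (ratio ^ Suc n, ratio ^ n))"

text \<open>After a deviation the seller believes that she faces the highest type in the message, which
  leaves every deviator with payoff 0.\<close>

definition greedy_assessment :: assessment where
  "greedy_assessment = \<lparr>
     message = (\<lambda>t. if 0 < t then (ratio * segment_top t, segment_top t) else (0, 0)),
     price = (\<lambda>m. if m \<in> greedy_messages then fst m else snd m),
     buys = (\<lambda>t m q. q \<le> t),
     belief = (\<lambda>m. if m \<in> greedy_messages then uniform_measure P {fst m<..snd m}
       else return borel (snd m))\<rparr>"

lemma segment_top_eq:
  assumes "t \<in> {ratio ^ Suc n<..ratio ^ n}"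
  shows "segment_top t = ratio ^ n"
proof -
  have t: "0 < t" using assms ratio_power_bounds(1)[of "Suc n"] by auto
  have ln: "ln ratio < 0" using ratio_pos ratio_less_1 by simp
  have "ln t \<le> ln (ratio ^ n)" "ln (ratio ^ Suc n) < ln t"
    using assms t ratio_power_bounds(1)[of n] ratio_power_bounds(1)[of "Suc n"] by (auto simp del: power_Suc)
  then have "ln t \<le> real n * ln ratio" "(real n + 1) * ln ratio < ln t"
    using ratio_pos ln_realpow[of ratio "Suc n"] by (auto simp: ln_realpow add.commute simp del: power_Suc)
  \<comment> \<open>Division by the negative \<open>ln ratio\<close> reverses both inequalities,
    leaving the strict one on the side that the floor needs.\<close>
  then have "real n \<le> log ratio t" "log ratio t < real n + 1"
    using ln unfolding log_def by (auto simp: neg_le_divide_eq neg_divide_less_eq)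
  then have "\<lfloor>log ratio t\<rfloor> = int n" by (intro floor_unique) auto
  then show ?thesis unfolding segment_top_def using ratio_pos by (simp add: powr_realpow)
qed

lemma greedy_message:
  assumes "t \<in> {ratio ^ Suc n<..ratio ^ n}"
  shows "message greedy_assessment t = (ratio ^ Suc n, ratio ^ n)"
proof -
  have "0 < t" using assms ratio_power_bounds(1)[of "Suc n"] by (auto simp del: power_Suc)
  then show ?thesis using segment_top_eq[OF assms] by (simp add: greedy_assessment_def)
qed

lemma greedy_message_0: "message greedy_assessment 0 = (0, 0)"
  by (simp add: greedy_assessment_def)

lemma zero_notin_greedy_messages: "(0, 0) \<notin> greedy_messages"
  using ratio_pos by (auto simp: greedy_messages_def)

lemma segment_subset: "{ratio ^ Suc n<..ratio ^ n} \<subseteq> {0<..1}"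
  using ratio_power_bounds[of n] ratio_power_bounds(1)[of "Suc n"] by (auto simp del: power_Suc)

lemma type_cases:
  assumes "t \<in> {0..1::real}"
  obtains "t = 0" | n where "t \<in> {ratio ^ Suc n<..ratio ^ n}"
proof (cases "t = 0")
  case False
  then show thesis using ratio_segment_exists[of t] assms that(2) by auto
qed (rule that(1))

lemma measure_segment_pos: "0 < measure P {ratio ^ Suc n<..ratio ^ n}"
  using ratio_power_bounds[of n] ratio_power_bounds(1)[of "Suc n"] k_pos
    measure_Ioc[of "ratio ^ Suc n" "ratio ^ n"] powr_less_mono2[of k "ratio ^ Suc n" "ratio ^ n"]
  by (simp del: power_Suc)

lemma greedy_belief_prob:
  assumes "m \<in> greedy_messages"
  shows "prob_space (uniform_measure P {fst m<..snd m})"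
  using assms measure_segment_pos
  by (intro prob_space_uniform_measure)
    (auto simp: greedy_messages_def emeasure_eq_measure less_imp_neq[symmetric] simp del: power_Suc)

lemma greedy_feasible: "feasible 0 1 greedy_assessment"
  unfolding feasible_def
proof (intro conjI ballI)
  have [measurable]: "segment_top \<in> borel_measurable borel"
    unfolding segment_top_def[abs_def] by measurable
  have "(\<lambda>t. if 0 < t then (ratio * segment_top t, segment_top t) else (0, 0)) \<in> borel \<rightarrow>\<^sub>M borel"
    by measurable
  then show "message greedy_assessment \<in> restrict_space borel {0..1} \<rightarrow>\<^sub>M borel"
    unfolding greedy_assessment_def by (simp add: measurable_restrict_space1)
  show "message greedy_assessment t \<in> messages 0 1 t" if "t \<in> {0..1}" for t
    using that
  proof (cases rule: type_cases)
    case 1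
    then show ?thesis by (simp add: greedy_message_0 messages_def)
  next
    case (2 n)
    then show ?thesis
      using greedy_message[OF 2] ratio_power_bounds[of n] ratio_power_bounds(1)[of "Suc n"]
      by (auto simp: messages_def simp del: power_Suc)
  qed
  \<comment> \<open>Measurable because it differs from \<open>snd\<close> at countably many messages
    only.\<close>
  have "(\<lambda>m. if m \<in> greedy_messages then fst m else snd m) \<in> borel_measurable borel"
  proof (rule measurable_discrete_difference)
    show "snd \<in> borel_measurable (borel :: (real \<times> real) measure)"
      by (intro borel_measurable_continuous_onI continuous_intros)
    show "countable greedy_messages" by (simp add: greedy_messages_def)
  qed auto
  then show "price greedy_assessment \<in> restrict_space borel (message_space 0 1) \<rightarrow>\<^sub>M borel"
    unfolding greedy_assessment_def by (simp add: measurable_restrict_space1)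
  show "0 \<le> price greedy_assessment m" if "m \<in> message_space 0 1" for m
    using that by (auto simp: greedy_assessment_def message_space_eq)
qed

lemma greedy_beliefs_supported: "beliefs_supported 0 1 greedy_assessment"
  unfolding beliefs_supported_def
proof (intro conjI ballI)
  have "(\<lambda>m. if m \<in> greedy_messages then uniform_measure P {fst m<..snd m} else return borel (snd m))
      \<in> borel \<rightarrow>\<^sub>M prob_algebra borel"
  proof (rule measurable_discrete_difference)
    show "(\<lambda>m::real \<times> real. return borel (snd m)) \<in> borel \<rightarrow>\<^sub>M prob_algebra borel"
      by (rule measurable_compose[OF _ measurable_return_prob_space])
        (intro borel_measurable_continuous_onI continuous_intros)
    show "countable greedy_messages" by (simp add: greedy_messages_def)
  qed (use greedy_belief_prob in \<open>auto simp: space_prob_algebra\<close>)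
  then show "belief greedy_assessment \<in> restrict_space borel (message_space 0 1) \<rightarrow>\<^sub>M prob_algebra borel"
    unfolding greedy_assessment_def by (simp add: measurable_restrict_space1)
next
  fix m :: "real \<times> real" assume m: "m \<in> message_space 0 1"
  show "measure (belief greedy_assessment m) {fst m..snd m} = 1"
  proof (cases "m \<in> greedy_messages")
    case True
    then have "0 < measure P {fst m<..snd m}"
      using measure_segment_pos by (auto simp: greedy_messages_def simp del: power_Suc)
    moreover have "{fst m<..snd m} \<inter> {fst m..snd m} = {fst m<..snd m}" by auto
    ultimately show ?thesis using True by (simp add: greedy_assessment_def emeasure_eq_measure)
  next
    case False
    then show ?thesis using m by (auto simp: greedy_assessment_def message_space_eq measure_return)
  qed
qed

text \<open>Only countably many messages are sent, so the conditional distribution reduces to the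
  elementary Bayes formula on each cell of types sending the same message.\<close>

lemma greedy_bayes_consistent: "bayes_consistent P 0 1 greedy_assessment"
  unfolding bayes_consistent_def
proof (intro ballI)
  fix A :: "real set" and B :: "(real \<times> real) set"
  assume A: "A \<in> sets borel" and B: "B \<in> sets borel"
  \<comment> \<open>Cell 0 is type 0 alone; cell \<open>Suc n\<close> is the segment with top
    \<open>ratio ^ n\<close>.\<close>
  define X where "X n = (case n of 0 \<Rightarrow> {0} | Suc n \<Rightarrow> {ratio ^ Suc n<..ratio ^ n})" for n :: nat
  define \<mu> where "\<mu> n = (case n of 0 \<Rightarrow> (0, 0) | Suc n \<Rightarrow> (ratio ^ Suc n, ratio ^ n))" for n :: nat
  define J where "J n = (if \<mu> n \<in> B then X n else {})" for n
  let ?f = "\<lambda>t. measure (belief greedy_assessment (message greedy_assessment t)) A"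
  have msg: "message greedy_assessment t = \<mu> n" if "t \<in> X n" for t n
    using that greedy_message greedy_message_0 by (auto simp: X_def \<mu>_def split: nat.splits simp del: power_Suc)
  have X: "X n \<in> sets borel" "X n \<subseteq> {0..1}" for n
    using segment_subset by (fastforce simp: X_def split: nat.splits simp del: power_Suc)+
  have UN: "{0..1} = (\<Union>n. X n)"
  proof
    show "{0..1} \<subseteq> (\<Union>n. X n)"
    proof
      fix t :: real assume "t \<in> {0..1}"
      then show "t \<in> (\<Union>n. X n)"
      proof (cases rule: type_cases)
        case 1
        then show ?thesis by (auto simp: X_def intro: exI[of _ 0])
      next
        case (2 n)
        then show ?thesis by (auto simp: X_def simp del: power_Suc intro!: exI[of _ "Suc n"])
      qed
    qed
  qed (use X in blast)
  have disj: "X i \<inter> X j = {}" if "i \<noteq> j" for i j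
  proof -
    have zero: "0 \<notin> X (Suc n)" for n
      using segment_subset[of n] unfolding X_def nat.case by force
    have Suc: "m = n" if "t \<in> X (Suc m)" "t \<in> X (Suc n)" for t m n
      using that unfolding X_def nat.case by (rule ratio_segment_unique)
    have "i = j" if "t \<in> X i" "t \<in> X j" for t
    proof (cases "t = 0")
      case True
      then show ?thesis using that zero by (metis not0_implies_Suc)
    next
      case False
      then have "i \<noteq> 0" "j \<noteq> 0" using that unfolding X_def by (auto intro!: Nat.gr0I)
      then show ?thesis using that Suc by (metis not0_implies_Suc)
    qed
    then show ?thesis using that by blast
  qed
  have J: "J n \<in> sets borel" "J n \<subseteq> {0..1}" for n using X by (auto simp: J_def)
  have disjJ: "J i \<inter> J j = {}" if "i \<noteq> j" for i j using disj[OF that] by (auto simp: J_def)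
  have T: "{t \<in> {0..1}. message greedy_assessment t \<in> B} = (\<Union>n. J n)"
    unfolding UN J_def using msg by (auto split: if_splits)
  have "(LINT t:J n|P. ?f t) = measure P (A \<inter> J n)" for n
  proof (cases "\<mu> n \<in> B")
    case True
    have "(LINT t:J n|P. ?f t) = (LINT t:J n|P. measure (belief greedy_assessment (\<mu> n)) A)"
      using J(1)[of n] msg True by (intro set_lebesgue_integral_cong) (auto simp: J_def)
    also have "\<dots> = measure (belief greedy_assessment (\<mu> n)) A * measure P (X n)"
      using True X(1)[of n] by (simp add: set_lebesgue_integral_def J_def)
    also have "\<dots> = measure P (A \<inter> X n)"
    proof (cases n)
      \<comment> \<open>Type 0 has probability zero, so both sides vanish whatever is believed after
        \<open>(0, 0)\<close>.\<close>
      case 0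
      then have "measure P (A \<inter> X n) \<le> measure P {0}"
        by (intro finite_measure_mono) (auto simp: X_def)
      then show ?thesis using measure_singleton[of 0] 0 by (simp add: X_def measure_le_0_iff)
    next
      case (Suc n')
      have "\<mu> n \<in> greedy_messages" by (auto simp: Suc \<mu>_def greedy_messages_def)
      then show ?thesis
        using A measure_segment_pos[of n'] unfolding Suc X_def \<mu>_def
        by (simp add: greedy_assessment_def emeasure_eq_measure Int_commute del: power_Suc)
    qed
    finally show ?thesis using True by (simp add: J_def)
  qed (simp add: J_def set_lebesgue_integral_def)
  moreover have "(LINT t:(\<Union>n. J n)|P. ?f t) = (\<Sum>n. LINT t:J n|P. ?f t)"
    using J disjJ set_integrable_belief[OF greedy_feasible greedy_beliefs_supported A, of "\<Union>n. J n"]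
    by (intro lebesgue_integral_countable_add) auto
  moreover have "(\<lambda>n. measure P (A \<inter> J n)) sums measure P (\<Union>n. A \<inter> J n)"
  proof (rule finite_measure_UNION)
    show "disjoint_family (\<lambda>n. A \<inter> J n)" unfolding disjoint_family_on_def using disjJ by blast
  qed (use J A in auto)
  moreover have "{t \<in> {0..1}. t \<in> A \<and> message greedy_assessment t \<in> B} = (\<Union>n. A \<inter> J n)"
    using T by blast
  ultimately show "measure P {t \<in> {0..1}. t \<in> A \<and> message greedy_assessment t \<in> B} =
      (LINT t:{t \<in> {0..1}. message greedy_assessment t \<in> B}|P. ?f t)"
    using T by (simp add: sums_iff)
qed

text \<open>After a greedy message, prices inside the segment earn a multiple of the revenue against
  \<open>{0..b}\<close>, which peaks at the lower end; lower prices gain no buyers. After other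
  messages the belief is a point mass at the top, which is the price charged.\<close>

lemma greedy_pricing_rational: "pricing_rational 0 1 greedy_assessment"
  unfolding pricing_rational_def
proof (intro ballI allI impI)
  fix m :: "real \<times> real" and q :: real
  assume m: "m \<in> message_space 0 1" and q: "0 \<le> q"
  show "expected_revenue greedy_assessment m q \<le> expected_revenue greedy_assessment m (price greedy_assessment m)"
  proof (cases "m \<in> greedy_messages")
    case True
    then obtain n where n: "m = (ratio ^ Suc n, ratio ^ n)" by (auto simp: greedy_messages_def)
    define a b where "a = ratio ^ Suc n" and "b = ratio ^ n"
    have ab: "0 < a" "a < b" "b \<le> 1" "a = ratio * b"
      using ratio_power_bounds[of n] ratio_power_bounds(1)[of "Suc n"] by (auto simp: a_def b_def)
    define D where "D = measure P {a<..b}"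
    have D: "0 < D" "D = b powr k - a powr k"
      using measure_segment_pos[of n] measure_Ioc[of a b] ab(1-3) unfolding D_def a_def b_def
      by (auto simp del: power_Suc)
    have rev: "expected_revenue greedy_assessment m x = x * (measure P ({a<..b} \<inter> {x..b}) / D)" for x
    proof -
      have "{a<..b} \<inter> {t \<in> {a..b}. x \<le> t} = {a<..b} \<inter> {x..b}" by auto
      moreover have "{t \<in> {a..b}. x \<le> t} = {a..b} \<inter> {x..}" by auto
      ultimately show ?thesis
        using True D unfolding expected_revenue_def n a_def[symmetric] b_def[symmetric]
        by (simp add: greedy_assessment_def emeasure_eq_measure D_def)
    qed
    have "q * measure P ({a<..b} \<inter> {q..b}) \<le> a * D"
    proof (cases "q \<le> a")
      case True
      then have "{a<..b} \<inter> {q..b} = {a<..b}" by auto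
      then show ?thesis using True D by (simp add: D_def)
    next
      case False
      show ?thesis
      proof (cases "q \<le> b")
        case True
        have "{a<..b} \<inter> {q..b} = {q..b}" using False by auto
        then have "q * measure P ({a<..b} \<inter> {q..b}) = q * (b powr k - q powr k)"
          using measure_Icc[of q b] q True ab by simp
        then show ?thesis using revenue_less_ratio[of q b] q ab D False by simp
      next
        case False
        then have "{a<..b} \<inter> {q..b} = {}" by auto
        then show ?thesis using ab D by simp
      qed
    qed
    moreover have "{a<..b} \<inter> {a..b} = {a<..b}" by auto
    moreover have "price greedy_assessment m = a" using True by (simp add: greedy_assessment_def n a_def)
    ultimately show ?thesis using D by (simp add: rev D_def[symmetric] pos_divide_le_eq)
  next
    case False
    then show ?thesis
      using m q by (auto simp: expected_revenue_def greedy_assessment_def measure_return indicator_def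
          message_space_eq)
  qed
qed

text \<open>Only a greedy message can leave a positive payoff, and then the type lies in its
  segment, so it is the message she sends anyway.\<close>

lemma greedy_disclosure_rational: "disclosure_rational 0 1 greedy_assessment"
  unfolding disclosure_rational_def
proof (intro ballI)
  fix t :: real and m assume t: "t \<in> {0..1}" and m: "m \<in> messages 0 1 t"
  have nonneg: "0 \<le> consumer_payoff greedy_assessment t m'" for m'
    by (simp add: consumer_payoff_def greedy_assessment_def)
  show "consumer_payoff greedy_assessment t m \<le>
      consumer_payoff greedy_assessment t (message greedy_assessment t)"
  proof (cases "consumer_payoff greedy_assessment t m \<le> 0")
    case True
    then show ?thesis using nonneg order_trans by blast
  next
    case False
    have "m \<in> greedy_messages"
    proof (rule ccontr)
      assume "m \<notin> greedy_messages"
      then show False using False m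
        by (auto simp: consumer_payoff_def greedy_assessment_def messages_def split: if_splits)
    qed
    then obtain n where n: "m = (ratio ^ Suc n, ratio ^ n)" by (auto simp: greedy_messages_def)
    \<comment> \<open>A type at the common endpoint of two segments may also send the upper
      segment's message, but its price equals her value.\<close>
    have "t \<noteq> ratio ^ Suc n"
      using False \<open>m \<in> greedy_messages\<close> by (auto simp: consumer_payoff_def greedy_assessment_def n)
    then have "t \<in> {ratio ^ Suc n<..ratio ^ n}"
      using m by (auto simp: n messages_def)
    then show ?thesis using greedy_message n by simp
  qed
qed

lemma greedy_equilibrium: "equilibrium P 0 1 greedy_assessment"
  unfolding equilibrium_def
  using greedy_feasible greedy_beliefs_supported greedy_bayes_consistent greedy_pricing_rational
    greedy_disclosure_rational
  by (auto simp: purchase_rational_def greedy_assessment_def)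

lemma greedy_assessment_segmentation: "greedy_segmentation (cdf P) 0 1 greedy_assessment"
  unfolding greedy_segmentation_iff
proof (intro conjI allI impI)
  fix n t assume t: "t \<in> {ratio ^ Suc n<..ratio ^ n}"
  show "message greedy_assessment t = (ratio ^ Suc n, ratio ^ n)" by (rule greedy_message[OF t])
  have price: "price greedy_assessment (message greedy_assessment t) = ratio ^ Suc n"
    unfolding greedy_message[OF t] by (auto simp: greedy_assessment_def greedy_messages_def)
  show "price greedy_assessment (message greedy_assessment t) = ratio ^ Suc n" by (rule price)
  show "buys greedy_assessment t (message greedy_assessment t)
      (price greedy_assessment (message greedy_assessment t))"
    unfolding price using t by (simp add: greedy_assessment_def)
qed (use zero_notin_greedy_messages in \<open>auto simp: greedy_assessment_def\<close>)

end

theorem proposition4: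
  fixes P :: "real measure" and k :: real
  assumes "real_distribution P"
    and "k > 0"
    and "\<And>v. v \<in> {0..1} \<Longrightarrow> cdf P v = v powr k"
  shows "(\<exists>\<sigma>. equilibrium P 0 1 \<sigma> \<and> greedy_segmentation (cdf P) 0 1 \<sigma>) \<and>
    (\<forall>\<sigma>. equilibrium P 0 1 \<sigma> \<and> greedy_segmentation (cdf P) 0 1 \<sigma> \<longrightarrow>
      consumer_optimal_equilibrium P 0 1 \<sigma>)"
proof -
  interpret real_distribution P by (rule assms(1))
  interpret power_distribution P k by unfold_locales (use assms in auto)
  show ?thesis
    using greedy_equilibrium greedy_assessment_segmentation greedy_consumer_optimal by blast
qed

end
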